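(* Let $1<p<\infty$. If $F\in H^p(\Omega_+)$ and $F(\zeta)$, $\zeta\in\Gamma$, denotes the upright down boundary limit of $F$ on $\Gamma$, then $F(\zeta)$ is also the non-tangential boundary limit of $F$; that is, for almost every $\zeta_0\in\Gamma$ (with respect to arc length), $F$ has non-tangential boundary limit $F(\zeta_0)$ at $\zeta_0$.
   Context: Let $a\colon\mathbb{R}\to\mathbb{R}$ satisfy $|a(u_1)-a(u_2)|\le M|u_1-u_2|$ for all $u_1,u_2\in\mathbb{R}$, with a fixed $M>0$. Let $\Gamma=\{\zeta(u)=u+\mathrm{i}a(u)\colon u\in\mathbb{R}\}$, with arc length measure $|\mathrm{d}\zeta|$, and $\Omega_+=\{u+\mathrm{i}v\colon v>a(u)\}$. $H^p(\Omega_+)$ is the space of holomorphic $F$ on $\Omega_+$ with $\sup_{\tau>0}\int_{\Gamma}|F(\zeta+\mathrm{i}\tau)|^p\,|\mathrm{d}\zeta|<\infty$. The upright down boundary limit of $F$ at $\zeta\in\Gamma$ is $\lim_{\tau\to0^+}F(\zeta+\mathrm{i}\tau)$; it is known (Meyer–Coifman) that for $F\in H^p(\Omega_+)$ it exists for a.e. $\zeta\in\Gamma$, belongs to $L^p(\Gamma,|\mathrm{d}\zeta|)$, and that $\frac1{2\pi\mathrm{i}}\int_\Gamma\frac{F(\zeta)}{\zeta-w}\,\mathrm{d}\zeta$ equals $F(w)$ for $w\in\Omega_+$ and $0$ for $w\in\Omega_-=\{u+\mathrm{i}v\colon v<a(u)\}$. Non-tangential limits: let $\zeta_0=\zeta(u_0)$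 be such that $\zeta'(u_0)=|\zeta'(u_0)|\mathrm{e}^{\mathrm{i}\phi_0}$ exists, with $\phi_0\in(-\frac\pi2,\frac\pi2)$. For $\phi\in(0,\frac\pi2)$ let $\Omega_\phi(\zeta_0)=\{\zeta_0+r\mathrm{e}^{\mathrm{i}\theta}\colon r>0,\ \theta-\phi_0\in(\phi,\pi-\phi)\}$. A function $F$ on $\Omega_+$ has non-tangential boundary limit $l$ at $\zeta_0$ if for every $\phi\in(0,\frac\pi2)$, $F(w)\to l$ as $w\to\zeta_0$ with $w\in\Omega_\phi(\zeta_0)\cap\Omega_+$. *)

theory Defs
  imports "HOL-Analysis.Analysis"
begin

definition graph_param :: "(real \<Rightarrow> real) \<Rightarrow> real \<Rightarrow> complex" where
  "graph_param a u = Complex u (a u)"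

definition graph_curve :: "(real \<Rightarrow> real) \<Rightarrow> complex set" where
  "graph_curve a = range (graph_param a)"

definition upper_domain :: "(real \<Rightarrow> real) \<Rightarrow> complex set" where
  "upper_domain a = {w. a (Re w) < Im w}"

(* The measure |d zeta| = |zeta'(u)| du, carried over to the Borel sets of the curve.
   For Lipschitz a the derivative exists for almost every u; where it does not exist,
   vector_derivative is a fixed unspecified value, which affects only a null set. *)
definition arc_length_measure :: "(real \<Rightarrow> real) \<Rightarrow> complex measure" where
  "arc_length_measure a =
     distr (density lborel (\<lambda>u. ennreal (norm (vector_derivative (graph_param a) (at u)))))
       (restrict_space borel (graph_curve a)) (graph_param a)"

definition hardy_space :: "(real \<Rightarrow> real) \<Rightarrow> real \<Rightarrow> (complex \<Rightarrow> complex) set" where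
  "hardy_space a p =
     {F. F holomorphic_on upper_domain a \<and>
         (SUP \<tau>\<in>{0<..}. \<integral>\<^sup>+ z. ennreal (norm (F (z + \<i> * complex_of_real \<tau>)) powr p)
            \<partial>arc_length_measure a) < \<infinity>}"

(* Only the values of F at points z + i tau with tau > 0 matter. *)
definition upright_limit :: "(complex \<Rightarrow> complex) \<Rightarrow> complex \<Rightarrow> complex" where
  "upright_limit F z = Lim (at_right 0) (\<lambda>\<tau>. F (z + \<i> * complex_of_real \<tau>))"

definition nontangential_sector :: "complex \<Rightarrow> real \<Rightarrow> real \<Rightarrow> complex set" where
  "nontangential_sector z\<^sub>0 \<phi>\<^sub>0 \<phi> =
     {z\<^sub>0 + complex_of_real r * cis \<theta> | r \<theta>. 0 < r \<and> \<theta> - \<phi>\<^sub>0 \<in> {\<phi><..<pi - \<phi>}}"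

(* Existence of the tangent direction at z0 is part of the notion. Since zeta' has real part 1,
   the angle phi0 is unique. The vertical direction lies in the sectors with small phi, so a
   non-tangential limit is in particular an upright one; hence
   has_nontangential_limit a F z (upright_limit F z) never refers to an unspecified Lim. *)
definition has_nontangential_limit ::
    "(real \<Rightarrow> real) \<Rightarrow> (complex \<Rightarrow> complex) \<Rightarrow> complex \<Rightarrow> complex \<Rightarrow> bool" where
  "has_nontangential_limit a F z\<^sub>0 l \<longleftrightarrow>
     (\<exists>u\<^sub>0 d \<phi>\<^sub>0. z\<^sub>0 = graph_param a u\<^sub>0 \<and>
        (graph_param a has_vector_derivative d) (at u\<^sub>0) \<and>
        \<phi>\<^sub>0 \<in> {-pi/2<..<pi/2} \<and> d = complex_of_real (norm d) * cis \<phi>\<^sub>0 \<and>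
        (\<forall>\<phi>\<in>{0<..<pi/2}.
           (F \<longlongrightarrow> l) (at z\<^sub>0 within (nontangential_sector z\<^sub>0 \<phi>\<^sub>0 \<phi> \<inter> upper_domain a))))"

end

theory Submission
  imports Defs "HOL-Complex_Analysis.Complex_Analysis" "HOL-Real_Asymp.Real_Asymp"
begin

text \<open>
The proof works with a holomorphic primitive \<open>\<Phi>\<close> of \<open>F\<close>, because a statement about almost every
boundary value of \<open>F\<close> becomes a statement about differentiability of the boundary values of \<open>\<Phi>\<close>.
Write \<open>\<zeta>(u) = u + \<i> a(u)\<close>.

Along the shifted curves \<open>\<zeta> + \<i>\<tau>\<close> the increments of \<open>\<Phi>\<close> are bounded by integrals of \<open>|F|\<close>. Since
\<open>p > 1\<close>, the bound on \<open>\<integral>|F|\<^sup>p\<close> makes the functions \<open>u \<mapsto> \<Phi>(\<zeta>(u) + \<i>\<tau>)\<close> equicontinuous, uniformly in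
\<open>\<tau>\<close> (\<open>equicontinuous\<close>). By Fubini, \<open>\<integral>\<^sub>0\<^sup>1 |F(\<zeta>(u) + \<i>t)| dt\<close> is finite for a dense set of \<open>u\<close>, and there
\<open>\<Phi>(\<zeta>(u) + \<i>\<tau>)\<close> converges as \<open>\<tau> \<rightarrow> 0\<close>. Together these facts extend \<open>\<Phi>\<close> continuously to the closed
domain (\<open>continuous_on_extension\<close>).

The increments of the boundary trace \<open>b(u)\<close> of \<open>\<Phi>\<close> are dominated by those of an increasing function,
namely a lower limit of \<open>u + \<integral>\<^sub>-\<^sub>\<infinity>\<^sup>u |F(\<zeta> + \<i>\<tau>)|\<^sup>p\<close>. Hence \<open>b\<close> is differentiable almost everywhere by
Lebesgue's theorem on monotone functions (\<open>mono_differentiable_ae\<close>, proved here from the Vitali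
covering theorem), and so is \<open>a\<close>.

Let \<open>a\<close> and \<open>b\<close> be differentiable at \<open>u\<^sub>0\<close>, and put \<open>\<zeta>\<^sub>0 = \<zeta>(u\<^sub>0)\<close> and \<open>l = b'(u\<^sub>0) / \<zeta>'(u\<^sub>0)\<close>. Then
\<open>\<Psi>(z) = \<Phi>(z) - \<Phi>(\<zeta>\<^sub>0) - l (z - \<zeta>\<^sub>0)\<close> is \<open>o(|z - \<zeta>\<^sub>0|)\<close> along the curve, and a Phragmen-Lindelof argument
(\<open>Phragmen_Lindelof_at_boundary_point\<close>) carries this estimate into the whole domain. For \<open>w\<close> in a
sector at \<open>\<zeta>\<^sub>0\<close>, a disc about \<open>w\<close> of radius comparable to \<open>|w - \<zeta>\<^sub>0|\<close> lies in the domain, so the Cauchy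
inequality for \<open>\<Psi>'\<close> gives \<open>F(w) - l = \<Psi>'(w) \<rightarrow> 0\<close>
(\<open>nontangential_limit_if_primitive_differentiable\<close>). The vertical ray lies in the sectors of
large opening, so \<open>l\<close> is also the upright limit.
\<close>

section \<open>Differentiability almost everywhere of monotone functions\<close>

text \<open>The exceptional sets in the proof of Lebesgue's theorem are not known to be measurable in advance,
so their sizes are compared by outer measure. This is what lets Vitali coverings, which cover only
up to a null set, give bounds for outer measures.\<close>

lemma outer_measure_of_le_modulo_negligible:
  fixes E A N :: "real set"
  assumes "E \<subseteq> A \<union> N" and "negligible N"
  shows "outer_measure_of lborel E \<le> outer_measure_of lborel A"
proof -
  obtain B where B: "B \<in> sets lborel" "A \<subseteq> B" "outer_measure_of lborel A = emeasure lborel B"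
    using outer_measure_of_attain[of A lborel] by auto
  have "N \<in> null_sets lebesgue"
    using assms(2) by (simp add: negligible_iff_null_sets)
  then obtain N' where N': "N' \<in> null_sets lborel" "N \<subseteq> N'"
    by (auto simp: null_sets_completion_iff2)
  have "outer_measure_of lborel E \<le> outer_measure_of lborel (B \<union> N')"
    using assms(1) B(2) N'(2) by (intro outer_measure_of_mono) auto
  also have "\<dots> = emeasure lborel (B \<union> N')"
    using B N' by (intro outer_measure_of_eq) auto
  also have "\<dots> = emeasure lborel B"
    using B N' by (simp add: emeasure_Un_null_set)
  finally show ?thesis using B by simp
qed

lemma negligible_if_outer_measure_zero:
  fixes E :: "real set"
  assumes "outer_measure_of lborel E = 0"
  shows "negligible E"
proof -
  obtain B where B: "B \<in> sets lborel" "E \<subseteq> B" "outer_measure_of lborel E = emeasure lborel B"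
    using outer_measure_of_attain[of E lborel] by auto
  have "B \<in> null_sets lborel" using B assms by auto
  then have "B \<in> null_sets lebesgue" by (rule null_sets_completionI)
  then show ?thesis
    using B(2) negligible_iff_null_sets negligible_subset by blast
qed

lemma Vitali_covering_intervals:
  fixes K :: "(real \<times> real) set" and E :: "real set"
  assumes K: "\<And>c d. (c, d) \<in> K \<Longrightarrow> c < d"
    and fine: "\<And>x \<delta>. x \<in> E \<Longrightarrow> 0 < \<delta> \<Longrightarrow> \<exists>c d. (c, d) \<in> K \<and> c \<le> x \<and> x \<le> d \<and> d - c < \<delta>"
  obtains C where "countable C" "C \<subseteq> K" "disjoint_family_on (\<lambda>(c, d). {c..d}) C"
    "negligible (E - (\<Union>(c, d)\<in>C. {c..d}))"
proof -
  define ctr rad where "ctr = (\<lambda>i::real\<times>real. (fst i + snd i) / 2)"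
    and "rad = (\<lambda>i::real\<times>real. (snd i - fst i) / 2)"
  have ball: "cball (ctr i) (rad i) = (\<lambda>(c, d). {c..d}) i" for i
    by (cases i) (simp add: ctr_def rad_def cball_eq_atLeastAtMost field_simps)
  have r: "0 < rad i" if "i \<in> K" for i
    using K[of "fst i" "snd i"] that by (simp add: rad_def)
  have S: "\<exists>i. i \<in> K \<and> x \<in> cball (ctr i) (rad i) \<and> rad i < \<delta>" if "x \<in> E" "0 < \<delta>" for x \<delta>
  proof -
    obtain c d where "(c, d) \<in> K" "c \<le> x" "x \<le> d" "d - c < \<delta>"
      using fine \<open>x \<in> E\<close> \<open>0 < \<delta>\<close> by blast
    then show ?thesis
      using K[of c d] by (intro exI[of _ "(c, d)"]) (unfold ball, auto simp: rad_def)
  qed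
  obtain C where C: "countable C" "C \<subseteq> K"
     "pairwise (\<lambda>i j. disjnt (cball (ctr i) (rad i)) (cball (ctr j) (rad j))) C"
     "negligible(E - (\<Union>i \<in> C. cball (ctr i) (rad i)))"
    using Vitali_covering_theorem_cballs[of K rad E ctr, OF r S] by blast
  show thesis
  proof (rule that[of C])
    show "disjoint_family_on (\<lambda>(c, d). {c..d}) C"
      using C(3) unfolding ball pairwise_def disjoint_family_on_def disjnt_def by auto
    show "negligible (E - (\<Union>(c, d)\<in>C. {c..d}))"
      using C(4) unfolding ball by simp
  qed (use C in auto)
qed

text \<open>For increasing \<open>f\<close>, disjoint intervals \<open>[c, d]\<close> have disjoint image intervals \<open>(f c, f d)\<close>. So a sum
of increments of \<open>f\<close> is the Lebesgue measure of a union, and sums over different families of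
intervals can be compared by inclusion.\<close>

lemma emeasure_image_intervals:
  fixes f :: "real \<Rightarrow> real"
  assumes f: "mono f" and C: "countable C" "\<And>c d. (c, d) \<in> C \<Longrightarrow> c < d"
    and disj: "disjoint_family_on (\<lambda>(c, d). {c..d}) C"
  shows "emeasure lborel (\<Union>(c, d)\<in>C. {f c<..<f d}) = (\<integral>\<^sup>+(c, d). ennreal (f d - f c) \<partial>count_space C)"
proof -
  have dis: "disjoint_family_on (\<lambda>(c, d). {f c<..<f d}) C"
    unfolding disjoint_family_on_def
  proof (intro ballI impI)
    fix i j assume ij: "i \<in> C" "j \<in> C" "i \<noteq> j"
    obtain c d c' d' where eq: "i = (c, d)" "j = (c', d')" by fastforce
    have i: "(c, d) \<in> C" "(c', d') \<in> C" and ne: "(c, d) \<noteq> (c', d')"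
      using ij unfolding eq by auto
    have "{c..d} \<inter> {c'..d'} = {}"
      using disj i ne unfolding disjoint_family_on_def by fastforce
    then have "max c c' \<notin> {c..d} \<inter> {c'..d'}"
      by simp
    moreover have "c < d" "c' < d'"
      using C(2) i by auto
    ultimately have "d < c' \<or> d' < c"
      unfolding Int_iff atLeastAtMost_iff by linarith
    then have "f d \<le> f c' \<or> f d' \<le> f c"
      using monoD[OF f, of d c'] monoD[OF f, of d' c] by auto
    then show "(\<lambda>(c, d). {f c<..<f d}) i \<inter> (\<lambda>(c, d). {f c<..<f d}) j = {}"
      unfolding eq by auto
  qed
  have "emeasure lborel (\<Union>(c, d)\<in>C. {f c<..<f d}) 
      = (\<integral>\<^sup>+i. emeasure lborel ((\<lambda>(c, d). {f c<..<f d}) i) \<partial>count_space C)"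
    using C(1) dis by (intro emeasure_UN_countable) auto
  also have "\<dots> = (\<integral>\<^sup>+(c, d). ennreal (f d - f c) \<partial>count_space C)"
    using C(2) f by (intro nn_integral_cong) (auto simp: monoD[OF f] less_imp_le)
  finally show ?thesis .
qed

lemma emeasure_disjoint_intervals:
  fixes C :: "(real \<times> real) set"
  assumes C: "countable C" "\<And>c d. (c, d) \<in> C \<Longrightarrow> c < d"
    and disj: "disjoint_family_on (\<lambda>(c, d). {c..d}) C"
  shows "emeasure lborel (\<Union>(c, d)\<in>C. {c..d}) = (\<integral>\<^sup>+(c, d). ennreal (d - c) \<partial>count_space C)"
proof -
  have "emeasure lborel (\<Union>(c, d)\<in>C. {c..d}) 
      = (\<integral>\<^sup>+i. emeasure lborel ((\<lambda>(c, d). {c..d}) i) \<partial>count_space C)"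
    using C(1) disj by (intro emeasure_UN_countable) auto
  also have "\<dots> = (\<integral>\<^sup>+(c, d). ennreal (d - c) \<partial>count_space C)"
    using C(2) by (intro nn_integral_cong) (auto simp: less_imp_le)
  finally show ?thesis .
qed

text \<open>In a disjoint Vitali subfamily that covers \<open>E\<close>, the total length is at least the outer measure of \<open>E\<close>,
and \<open>f\<close> stretches each interval at least by the factor \<open>q\<close>.\<close>

lemma outer_measure_le_if_steep_intervals:
  fixes f :: "real \<Rightarrow> real"
  assumes f: "mono f" and q: "0 \<le> q" and T: "T \<in> sets borel"
    and K: "\<And>c d. (c, d) \<in> K \<Longrightarrow> c < d \<and> q * (d - c) \<le> f d - f c \<and> {f c<..<f d} \<subseteq> T"
    and fine: "\<And>x \<delta>. x \<in> E \<Longrightarrow> 0 < \<delta> \<Longrightarrow> \<exists>c d. (c, d) \<in> K \<and> c \<le> x \<and> x \<le> d \<and> d - c < \<delta>"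
  shows "ennreal q * outer_measure_of lborel E \<le> emeasure lborel T"
proof -
  obtain C where C: "countable C" "C \<subseteq> K" "disjoint_family_on (\<lambda>(c, d). {c..d}) C"
    "negligible (E - (\<Union>(c, d)\<in>C. {c..d}))"
    using Vitali_covering_intervals[of K E] K fine by blast
  have lt: "\<And>c d. (c, d) \<in> C \<Longrightarrow> c < d" using C(2) K by blast
  have "outer_measure_of lborel E \<le> outer_measure_of lborel (\<Union>(c, d)\<in>C. {c..d})"
    by (rule outer_measure_of_le_modulo_negligible[OF _ C(4)]) auto
  also have "\<dots> = emeasure lborel (\<Union>(c, d)\<in>C. {c..d})"
    using C(1) by (intro outer_measure_of_eq) auto
  also have "\<dots> = (\<integral>\<^sup>+(c, d). ennreal (d - c) \<partial>count_space C)"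
    using emeasure_disjoint_intervals C lt by blast
  finally have "ennreal q * outer_measure_of lborel E
      \<le> ennreal q * (\<integral>\<^sup>+(c, d). ennreal (d - c) \<partial>count_space C)"
    by (rule mult_left_mono) simp
  also have "\<dots> = (\<integral>\<^sup>+i. ennreal q * (case i of (c, d) \<Rightarrow> ennreal (d - c)) \<partial>count_space C)"
    by (rule nn_integral_cmult[symmetric]) simp
  also have "\<dots> \<le> (\<integral>\<^sup>+(c, d). ennreal (f d - f c) \<partial>count_space C)"
  proof (rule nn_integral_mono)
    fix i assume "i \<in> space (count_space C)"
    then have "i \<in> K" using C(2) by auto
    then show "ennreal q * (case i of (c, d) \<Rightarrow> ennreal (d - c)) \<le> (case i of (c, d) \<Rightarrow> ennreal (f d - f c))"
      using K[of "fst i" "snd i"] q by (auto simp: split_beta ennreal_mult'[symmetric] intro!: ennreal_leI)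
  qed
  also have "\<dots> = emeasure lborel (\<Union>(c, d)\<in>C. {f c<..<f d})"
    using emeasure_image_intervals[OF f C(1) lt C(3)] by simp
  also have "\<dots> \<le> emeasure lborel T"
    using C(2) K T by (intro emeasure_mono) auto
  finally show ?thesis .
qed

text \<open>The counterpart for intervals on which \<open>f\<close> has slope at most \<open>p\<close>. The endpoints of the countably many
intervals form a null set, so the open intervals cover almost all of \<open>E\<close> too; inside these a second,
finer covering can be chosen.\<close>

lemma shallow_intervals_image_small:
  fixes f :: "real \<Rightarrow> real"
  assumes f: "mono f" and p: "0 \<le> p" and U: "U \<in> sets borel"
    and K: "\<And>c d. (c, d) \<in> K \<Longrightarrow> c < d \<and> f d - f c \<le> p * (d - c) \<and> {c..d} \<subseteq> U"
    and fine: "\<And>x \<delta>. x \<in> E \<Longrightarrow> 0 < \<delta> \<Longrightarrow> \<exists>c d. (c, d) \<in> K \<and> c \<le> x \<and> x \<le> d \<and> d - c < \<delta>"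
  obtains C where "countable C" "C \<subseteq> K" "negligible (E - (\<Union>(c, d)\<in>C. {c<..<d}))"
    "emeasure lborel (\<Union>(c, d)\<in>C. {f c<..<f d}) \<le> ennreal p * emeasure lborel U"
proof -
  obtain C where C: "countable C" "C \<subseteq> K" "disjoint_family_on (\<lambda>(c, d). {c..d}) C"
    "negligible (E - (\<Union>(c, d)\<in>C. {c..d}))"
    using Vitali_covering_intervals[of K E] K fine by blast
  have lt: "\<And>c d. (c, d) \<in> C \<Longrightarrow> c < d" using C(2) K by blast
  have "negligible (fst ` C \<union> snd ` C)"
    using C(1) by (simp add: negligible_iff_null_sets countable_imp_null_set_lborel null_sets_completionI)
  then have "negligible ((E - (\<Union>(c, d)\<in>C. {c..d})) \<union> (fst ` C \<union> snd ` C))"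
    using C(4) negligible_Un by blast
  moreover have "E - (\<Union>(c, d)\<in>C. {c<..<d}) \<subseteq> (E - (\<Union>(c, d)\<in>C. {c..d})) \<union> (fst ` C \<union> snd ` C)"
  proof
    fix x assume x: "x \<in> E - (\<Union>(c, d)\<in>C. {c<..<d})"
    show "x \<in> (E - (\<Union>(c, d)\<in>C. {c..d})) \<union> (fst ` C \<union> snd ` C)"
    proof (cases "x \<in> (\<Union>(c, d)\<in>C. {c..d})")
      case True
      then obtain c d where cd: "(c, d) \<in> C" "c \<le> x" "x \<le> d" by auto
      then have "\<not> (c < x \<and> x < d)" using x by auto
      then have "x = c \<or> x = d" using cd by auto
      then show ?thesis using cd(1) by force
    qed (use x in auto)
  qed
  ultimately have neg: "negligible (E - (\<Union>(c, d)\<in>C. {c<..<d}))"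
    using negligible_subset by blast
  have "emeasure lborel (\<Union>(c, d)\<in>C. {f c<..<f d}) = (\<integral>\<^sup>+(c, d). ennreal (f d - f c) \<partial>count_space C)"
    using emeasure_image_intervals[OF f C(1) lt C(3)] .
  also have "\<dots> \<le> (\<integral>\<^sup>+i. ennreal p * (case i of (c, d) \<Rightarrow> ennreal (d - c)) \<partial>count_space C)"
  proof (rule nn_integral_mono)
    fix i assume "i \<in> space (count_space C)"
    then have "i \<in> K" using C(2) by auto
    then show "(case i of (c, d) \<Rightarrow> ennreal (f d - f c)) \<le> ennreal p * (case i of (c, d) \<Rightarrow> ennreal (d - c))"
      using K[of "fst i" "snd i"] p by (auto simp: split_beta ennreal_mult'[symmetric] intro!: ennreal_leI)
  qed
  also have "\<dots> = ennreal p * (\<integral>\<^sup>+(c, d). ennreal (d - c) \<partial>count_space C)"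
    by (rule nn_integral_cmult) simp
  also have "\<dots> = ennreal p * emeasure lborel (\<Union>(c, d)\<in>C. {c..d})"
    using emeasure_disjoint_intervals[OF C(1) lt C(3)] by simp
  also have "\<dots> \<le> ennreal p * emeasure lborel U"
    using C(2) K U by (intro mult_left_mono emeasure_mono) auto
  finally show thesis using that C(1,2) neg by blast
qed

text \<open>The intervals only have to contain \<open>x\<close>, possibly as an endpoint. So both one-sided difference
quotients are included, and the families of these intervals are Vitali coverings.\<close>

definition shallow_at :: "(real \<Rightarrow> real) \<Rightarrow> real \<Rightarrow> real \<Rightarrow> bool" where
  "shallow_at f p x \<longleftrightarrow>
     (\<forall>\<delta>>0. \<exists>c d. c < d \<and> c \<le> x \<and> x \<le> d \<and> d - c < \<delta> \<and> f d - f c \<le> p * (d - c))"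

definition steep_at :: "(real \<Rightarrow> real) \<Rightarrow> real \<Rightarrow> real \<Rightarrow> bool" where
  "steep_at f q x \<longleftrightarrow>
     (\<forall>\<delta>>0. \<exists>c d. c < d \<and> c \<le> x \<and> x \<le> d \<and> d - c < \<delta> \<and> q * (d - c) \<le> f d - f c)"

lemma outer_measure_bounded_finite:
  fixes E :: "real set"
  assumes "E \<subseteq> {A..B}"
  shows "outer_measure_of lborel E < \<infinity>"
proof -
  have "outer_measure_of lborel E \<le> outer_measure_of lborel {A..B}"
    using assms by (rule outer_measure_of_mono)
  also have "\<dots> = emeasure lborel {A..B}" by (rule outer_measure_of_eq) simp
  also have "\<dots> < \<infinity>" by (simp add: emeasure_lborel_Icc_eq)
  finally show ?thesis .
qed

lemma small_interval_inside_open: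
  fixes x :: real
  assumes "open U" "x \<in> U"
  obtains \<delta> where "\<delta> > 0" "\<And>c d. c \<le> x \<Longrightarrow> x \<le> d \<Longrightarrow> d - c < \<delta> \<Longrightarrow> {c..d} \<subseteq> U"
proof -
  obtain e where e: "e > 0" "ball x e \<subseteq> U" using assms openE by blast
  show thesis
  proof (rule that[of e])
    fix c d assume "c \<le> x" "x \<le> d" "d - c < e"
    then have "{c..d} \<subseteq> ball x e" by (auto simp: dist_real_def)
    then show "{c..d} \<subseteq> U" using e by blast
  qed (use e in auto)
qed

text \<open>Lebesgue's argument. Cover \<open>E\<close> by shallow intervals inside an open set \<open>U\<close> that is hardly larger than
\<open>E\<close>, and then the part of \<open>E\<close> in them by steep intervals inside the shallow ones. With \<open>s\<close> the outer
measure of \<open>E\<close>, comparing the images gives \<open>q s \<le> p |U|\<close>, hence \<open>q s \<le> p s\<close>.\<close>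

lemma negligible_shallow_and_steep:
  fixes f :: "real \<Rightarrow> real"
  assumes f: "mono f" and pq: "0 \<le> p" "p < q" and E: "E \<subseteq> {A..B}"
    and sh: "\<And>x. x \<in> E \<Longrightarrow> shallow_at f p x" and st: "\<And>x. x \<in> E \<Longrightarrow> steep_at f q x"
  shows "negligible E"
proof -
  let ?s = "outer_measure_of lborel E"
  have key: "ennreal q * ?s \<le> ennreal p * emeasure lborel U" if U: "open U" "E \<subseteq> U" for U
  proof -
    define K where "K = {(c, d). c < d \<and> f d - f c \<le> p * (d - c) \<and> {c..d} \<subseteq> U}"
    have fine: "\<exists>c d. (c, d) \<in> K \<and> c \<le> x \<and> x \<le> d \<and> d - c < \<delta>" if "x \<in> E" "0 < \<delta>" for x \<delta>
    proof -
      obtain e where e: "e > 0" "\<And>c d. c \<le> x \<Longrightarrow> x \<le> d \<Longrightarrow> d - c < e \<Longrightarrow> {c..d} \<subseteq> U"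
        using small_interval_inside_open U \<open>x \<in> E\<close> by blast
      have "min e \<delta> > 0" using e that by simp
      then obtain c d where "c < d \<and> c \<le> x \<and> x \<le> d \<and> d - c < min e \<delta> \<and> f d - f c \<le> p * (d - c)"
        using sh[OF \<open>x \<in> E\<close>] unfolding shallow_at_def by blast
      then show ?thesis unfolding K_def using e(2)[of c d] by auto
    qed
    obtain C where C: "countable C" "C \<subseteq> K" "negligible (E - (\<Union>(c, d)\<in>C. {c<..<d}))"
      "emeasure lborel (\<Union>(c, d)\<in>C. {f c<..<f d}) \<le> ennreal p * emeasure lborel U"
      by (rule shallow_intervals_image_small[OF f pq(1), of U K E]) (use U fine in \<open>auto simp: K_def\<close>)
    define T where "T = (\<Union>(c, d)\<in>C. {f c<..<f d})"
    define E' where "E' = E \<inter> (\<Union>(c, d)\<in>C. {c<..<d})"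
    define K' where "K' = {(c, d). c < d \<and> q * (d - c) \<le> f d - f c \<and> (\<exists>(c', d')\<in>C. {c..d} \<subseteq> {c'<..<d'})}"
    have fine': "\<exists>c d. (c, d) \<in> K' \<and> c \<le> x \<and> x \<le> d \<and> d - c < \<delta>" if "x \<in> E'" "0 < \<delta>" for x \<delta>
    proof -
      obtain c' d' where c': "(c', d') \<in> C" "x \<in> {c'<..<d'}" using \<open>x \<in> E'\<close> unfolding E'_def by blast
      obtain e where e: "e > 0" "\<And>c d. c \<le> x \<Longrightarrow> x \<le> d \<Longrightarrow> d - c < e \<Longrightarrow> {c..d} \<subseteq> {c'<..<d'}"
        using small_interval_inside_open[of "{c'<..<d'}"] c'(2) open_greaterThanLessThan by metis
      have "min e \<delta> > 0" using e that by simp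
      then obtain c d where "c < d \<and> c \<le> x \<and> x \<le> d \<and> d - c < min e \<delta> \<and> q * (d - c) \<le> f d - f c"
        using st[of x] \<open>x \<in> E'\<close> unfolding steep_at_def E'_def by blast
      then show ?thesis unfolding K'_def using e(2)[of c d] c'(1) by auto
    qed
    have "?s \<le> outer_measure_of lborel E'"
      by (rule outer_measure_of_le_modulo_negligible[OF _ C(3)]) (auto simp: E'_def)
    then have "ennreal q * ?s \<le> ennreal q * outer_measure_of lborel E'"
      by (rule mult_left_mono) simp
    also have "\<dots> \<le> emeasure lborel T"
    proof (rule outer_measure_le_if_steep_intervals[OF f _ _ _ fine'])
      show "0 \<le> q" using pq by simp
      show "T \<in> sets borel" unfolding T_def using C(1) by auto
    next
      fix c d assume "(c, d) \<in> K'"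
      then obtain c' d' where *: "c < d" "q * (d - c) \<le> f d - f c" "(c', d') \<in> C" "{c..d} \<subseteq> {c'<..<d'}"
        unfolding K'_def by blast
      then have "c \<in> {c'<..<d'}" "d \<in> {c'<..<d'}" by (meson atLeastAtMost_iff less_imp_le order_refl subsetD)+
      then have "c' \<le> c" "d \<le> d'" by auto
      then have "f c' \<le> f c" "f d \<le> f d'" using f monoD by blast+
      then have "{f c<..<f d} \<subseteq> {f c'<..<f d'}" by auto
      then show "c < d \<and> q * (d - c) \<le> f d - f c \<and> {f c<..<f d} \<subseteq> T"
        using * unfolding T_def by blast
    qed auto
    also have "\<dots> \<le> ennreal p * emeasure lborel U" using C(4) unfolding T_def .
    finally show ?thesis .
  qed
  obtain S where S: "S \<in> sets lborel" "E \<subseteq> S" "?s = emeasure lborel S"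
    using outer_measure_of_attain[of E lborel] by auto
  have fin: "?s < \<infinity>" by (rule outer_measure_bounded_finite[OF E])
  then obtain r where r: "r \<ge> 0" "?s = ennreal r" by (cases ?s) auto
  have "q * r \<le> p * r + e" if "e > 0" for e
  proof -
    \<comment> \<open>\<open>U\<close> exceeds a measurable hull of \<open>E\<close> by at most \<open>e'\<close>, which costs at most \<open>p e' \<le> e\<close>.\<close>
    define e' where "e' = e / (p + 1)"
    have e': "e' > 0" "p * e' \<le> e" using that pq by (auto simp: e'_def field_simps)
    obtain U where U: "open U" "S \<subseteq> U" "emeasure lborel (U - S) < e'"
      using outer_regular_lborel[of S e'] S(1) e' by auto
    have "emeasure lborel U \<le> emeasure lborel (S \<union> (U - S))"
      using S U by (intro emeasure_mono) auto
    also have "\<dots> \<le> emeasure lborel S + emeasure lborel (U - S)"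
      using S U by (intro emeasure_subadditive) auto
    also have "\<dots> \<le> ennreal r + ennreal e'"
      using U S r by (intro add_mono) auto
    also have "\<dots> = ennreal (r + e')" using r e' by simp
    finally have "ennreal q * ?s \<le> ennreal p * ennreal (r + e')"
      using key[OF U(1)] S(2) U(2) by (meson dual_order.trans mult_left_mono zero_le)
    then have "q * r \<le> p * (r + e')"
      using r pq e' by (simp add: ennreal_mult[symmetric] del: ennreal_plus)
    then show ?thesis using e' by (simp add: algebra_simps)
  qed
  then have "q * r \<le> p * r" by (rule field_le_epsilon)
  then have "(q - p) * r \<le> 0" by (simp add: algebra_simps)
  then have "r \<le> 0" using pq by (simp add: mult_le_0_iff)
  then have "r = 0" using r by simp
  then show ?thesis using r negligible_if_outer_measure_zero by simp
qed

text \<open>If \<open>f\<close> stretches \<open>E\<close> by every factor \<open>q\<close>, then \<open>q\<close> times the outer measure of \<open>E\<close> stays below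
\<open>f B - f A\<close>.\<close>

lemma negligible_infinitely_steep:
  fixes f :: "real \<Rightarrow> real"
  assumes f: "mono f" and E: "E \<subseteq> {A<..<B}"
    and st: "\<And>x q. x \<in> E \<Longrightarrow> 0 < q \<Longrightarrow> steep_at f q x"
  shows "negligible E"
proof -
  let ?s = "outer_measure_of lborel E"
  have key: "ennreal q * ?s \<le> emeasure lborel {f A<..<f B}" if q: "q > 0" for q
  proof -
    define K where "K = {(c, d). c < d \<and> q * (d - c) \<le> f d - f c \<and> {c..d} \<subseteq> {A<..<B}}"
    show ?thesis
    proof (rule outer_measure_le_if_steep_intervals[OF f, of _ _ K])
      fix x \<delta> :: real assume x: "x \<in> E" "0 < \<delta>"
      obtain e where e: "e > 0" "\<And>c d. c \<le> x \<Longrightarrow> x \<le> d \<Longrightarrow> d - c < e \<Longrightarrow> {c..d} \<subseteq> {A<..<B}"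
        using small_interval_inside_open[of "{A<..<B}" x] x E open_greaterThanLessThan by blast
      have "min e \<delta> > 0" using e x by simp
      then obtain c d where "c < d \<and> c \<le> x \<and> x \<le> d \<and> d - c < min e \<delta> \<and> q * (d - c) \<le> f d - f c"
        using st[OF \<open>x \<in> E\<close> q] unfolding steep_at_def by blast
      then show "\<exists>c d. (c, d) \<in> K \<and> c \<le> x \<and> x \<le> d \<and> d - c < \<delta>"
        unfolding K_def using e(2)[of c d] by auto
    next
      fix c d assume "(c, d) \<in> K"
      then have *: "c < d" "q * (d - c) \<le> f d - f c" "{c..d} \<subseteq> {A<..<B}" by (auto simp: K_def)
      then have "c \<in> {A<..<B}" "d \<in> {A<..<B}" by (meson atLeastAtMost_iff less_imp_le order_refl subsetD)+
      then have "A \<le> c" "d \<le> B" by auto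
      then have "f A \<le> f c" "f d \<le> f B" using f monoD by blast+
      then show "c < d \<and> q * (d - c) \<le> f d - f c \<and> {f c<..<f d} \<subseteq> {f A<..<f B}"
        using * by auto
    qed (use q in auto)
  qed
  have "E \<subseteq> {A..B}" using E by auto
  then have "?s < \<infinity>" by (rule outer_measure_bounded_finite)
  then obtain r where r: "r \<ge> 0" "?s = ennreal r" by (cases ?s) auto
  have "r \<le> 0"
  proof (rule ccontr)
    assume "\<not> r \<le> 0"
    then have "r > 0" by simp
    define D where "D = \<bar>f B - f A\<bar>"
    have "emeasure lborel {f A<..<f B} \<le> ennreal D"
      by (cases "f A \<le> f B") (auto simp: D_def)
    then have "ennreal ((D + 1) / r) * ennreal r \<le> ennreal D"
      using key[of "(D + 1) / r"] \<open>r > 0\<close> r by (auto simp: D_def intro: order_trans)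
    then show False using \<open>r > 0\<close> by (simp add: ennreal_mult[symmetric] D_def)
  qed
  then have "r = 0" using r by simp
  then show ?thesis using r negligible_if_outer_measure_zero by simp
qed

text \<open>If the difference quotients over small intervals around \<open>x\<close> do not oscillate between two rational
slopes, then they converge to the infimum of the positive slopes that eventually bound them from
above.\<close>

lemma mono_differentiable_at:
  fixes f :: "real \<Rightarrow> real"
  assumes f: "mono f" and fin: "0 < Q" "\<not> steep_at f Q x"
    and osc: "\<And>p q. p \<in> \<rat> \<Longrightarrow> q \<in> \<rat> \<Longrightarrow> 0 < p \<Longrightarrow> p < q \<Longrightarrow> shallow_at f p x \<Longrightarrow> steep_at f q x \<Longrightarrow> False"
  shows "f differentiable (at x)"
proof -
  define S where "S = {q. 0 < q \<and> \<not> steep_at f q x}"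
  define L where "L = Inf S"
  have S: "Q \<in> S" "bdd_below S" using fin by (auto simp: S_def intro!: bdd_belowI[of _ 0])
  have L0: "0 \<le> L" unfolding L_def using S by (intro cInf_greatest) (auto simp: S_def)
  have upper: "\<exists>\<delta>>0. \<forall>c d. c < d \<and> c \<le> x \<and> x \<le> d \<and> d - c < \<delta> \<longrightarrow> f d - f c < (L + e) * (d - c)"
    if "e > 0" for e
  proof -
    have "Inf S < L + e" using that by (simp add: L_def)
    then obtain q where q: "q \<in> S" "q < L + e" using S cInf_lessD by (metis empty_iff)
    then obtain \<delta> where \<delta>: "\<delta> > 0" "\<And>c d. c < d \<Longrightarrow> c \<le> x \<Longrightarrow> x \<le> d \<Longrightarrow> d - c < \<delta> \<Longrightarrow> f d - f c < q * (d - c)"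
      unfolding S_def steep_at_def by force
    show ?thesis
    proof (intro exI conjI allI impI)
      show "\<delta> > 0" by fact
      fix c d assume *: "c < d \<and> c \<le> x \<and> x \<le> d \<and> d - c < \<delta>"
      then have "f d - f c < q * (d - c)" using \<delta> by blast
      also have "\<dots> \<le> (L + e) * (d - c)" using * q by (intro mult_right_mono) auto
      finally show "f d - f c < (L + e) * (d - c)" .
    qed
  qed
  have lower: "\<exists>\<delta>>0. \<forall>c d. c < d \<and> c \<le> x \<and> x \<le> d \<and> d - c < \<delta> \<longrightarrow> (L - e) * (d - c) < f d - f c"
    if "e > 0" for e
  proof (cases "L = 0")
    case True
    show ?thesis
    proof (intro exI[of _ 1] conjI allI impI)
      fix c d assume *: "c < d \<and> c \<le> x \<and> x \<le> d \<and> d - c < 1"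
      then have "0 \<le> f d - f c" using monoD[OF f, of c d] by simp
      moreover have "(L - e) * (d - c) < 0" using True * that by (simp add: mult_pos_pos)
      ultimately show "(L - e) * (d - c) < f d - f c" by linarith
    qed simp
  next
    case False
    then have "max 0 (L - e) < L" using L0 that by auto
    then obtain p where p: "p \<in> \<rat>" "max 0 (L - e) < p" "p < L" using Rats_dense_in_real by blast
    obtain q where q: "q \<in> \<rat>" "p < q" "q < L" using Rats_dense_in_real p(3) by blast
    have "q \<notin> S" using q(3) S cInf_lower[of q S] unfolding L_def by force
    then have "steep_at f q x" using p q unfolding S_def by auto
    then have "\<not> shallow_at f p x" using osc[of p q] p q by auto
    then obtain \<delta> where \<delta>: "\<delta> > 0" "\<And>c d. c < d \<Longrightarrow> c \<le> x \<Longrightarrow> x \<le> d \<Longrightarrow> d - c < \<delta> \<Longrightarrow> p * (d - c) < f d - f c"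
      unfolding shallow_at_def by force
    show ?thesis
    proof (intro exI conjI allI impI)
      show "\<delta> > 0" by fact
      fix c d assume *: "c < d \<and> c \<le> x \<and> x \<le> d \<and> d - c < \<delta>"
      have "(L - e) * (d - c) \<le> p * (d - c)" using * p by (intro mult_right_mono) auto
      also have "\<dots> < f d - f c" using * \<delta> by blast
      finally show "(L - e) * (d - c) < f d - f c" .
    qed
  qed
  have "((\<lambda>y. (f y - f x) / (y - x)) \<longlongrightarrow> L) (at x)"
  proof (rule LIM_I)
    fix e :: real assume "e > 0"
    obtain \<delta>1 where d1: "\<delta>1 > 0" "\<And>c d. c < d \<Longrightarrow> c \<le> x \<Longrightarrow> x \<le> d \<Longrightarrow> d - c < \<delta>1 \<Longrightarrow> f d - f c < (L + e) * (d - c)"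
      using upper[OF \<open>e > 0\<close>] by blast
    obtain \<delta>2 where d2: "\<delta>2 > 0" "\<And>c d. c < d \<Longrightarrow> c \<le> x \<Longrightarrow> x \<le> d \<Longrightarrow> d - c < \<delta>2 \<Longrightarrow> (L - e) * (d - c) < f d - f c"
      using lower[OF \<open>e > 0\<close>] by blast
    show "\<exists>s>0. \<forall>y. y \<noteq> x \<and> norm (y - x) < s \<longrightarrow> norm ((f y - f x) / (y - x) - L) < e"
    proof (intro exI[of _ "min \<delta>1 \<delta>2"] conjI allI impI)
      fix y assume y: "y \<noteq> x \<and> norm (y - x) < min \<delta>1 \<delta>2"
      have y1: "y \<noteq> x" "\<bar>y - x\<bar> < \<delta>1" "\<bar>y - x\<bar> < \<delta>2" using y by auto
      define c d where "c = min x y" and "d = max x y"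
      have cd: "c < d" "c \<le> x" "x \<le> d" "d - c < \<delta>1" "d - c < \<delta>2"
        using y1 by (auto simp: c_def d_def min_def max_def)
      have eq: "(f y - f x) / (y - x) = (f d - f c) / (d - c)"
      proof (cases "x \<le> y")
        case False
        then have "(f d - f c) / (d - c) = (- (f y - f x)) / (- (y - x))" by (simp add: c_def d_def)
        then show ?thesis by (simp only: minus_divide_divide minus_divide_left minus_divide_right minus_minus)
      qed (simp add: c_def d_def)
      have "(f d - f c) / (d - c) < L + e" "L - e < (f d - f c) / (d - c)"
        using d1(2)[of c d] d2(2)[of c d] cd by (auto simp: pos_divide_less_eq pos_less_divide_eq)
      then show "norm ((f y - f x) / (y - x) - L) < e" unfolding eq by auto
    qed (use d1 d2 in auto)
  qed
  then have "(f has_field_derivative L) (at x)"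
    by (simp add: has_field_derivative_iff)
  then show ?thesis
    using real_differentiable_def by blast
qed

text \<open>Lebesgue's theorem. A point of non-differentiability is infinitely steep or lies, for one of
countably many pairs of rational slopes \<open>p < q\<close>, in a set that is both \<open>p\<close>-shallow and \<open>q\<close>-steep.\<close>

theorem mono_differentiable_ae:
  fixes f :: "real \<Rightarrow> real"
  assumes f: "mono f"
  shows "negligible {x. \<not> f differentiable (at x)}"
proof -
  define A where "A = (\<lambda>n::nat. {x. \<forall>q>0. steep_at f q x} \<inter> {- real n<..<real n})"
  define B where "B = (\<lambda>n::nat. \<lambda>p q. {x. shallow_at f p x \<and> steep_at f q x} \<inter> {- real n..real n})"
  define R where "R = {(p, q). p \<in> \<rat> \<and> q \<in> (\<rat>::real set) \<and> 0 < p \<and> p < q}"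
  have cR: "countable R"
    by (rule countable_subset[of _ "\<rat> \<times> \<rat>"]) (auto simp: R_def intro: countable_rat)
  have nA: "negligible (A n)" for n
    unfolding A_def by (rule negligible_infinitely_steep[OF f, of _ "- real n" "real n"]) auto
  have nB: "negligible (B n p q)" if "(p, q) \<in> R" for n p q
    by (rule negligible_shallow_and_steep[OF f, of p q _ "- real n" "real n"])
       (use that in \<open>auto simp: B_def R_def\<close>)
  have "negligible (\<Union>n. A n \<union> (\<Union>(p, q)\<in>R. B n p q))"
  proof (rule negligible_countable_Union)
    fix X assume "X \<in> range (\<lambda>n. A n \<union> (\<Union>(p, q)\<in>R. B n p q))"
    then obtain n where X: "X = A n \<union> (\<Union>(p, q)\<in>R. B n p q)" by blast
    have "negligible (\<Union>((\<lambda>(p, q). B n p q) ` R))"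
      using nB cR by (intro negligible_countable_Union) auto
    then show "negligible X"
      unfolding X using nA negligible_Un by blast
  qed simp
  moreover have "{x. \<not> f differentiable (at x)} \<subseteq> (\<Union>n. A n \<union> (\<Union>(p, q)\<in>R. B n p q))"
  proof
    fix x assume "x \<in> {x. \<not> f differentiable (at x)}"
    then have nd: "\<not> f differentiable (at x)" by simp
    obtain n :: nat where n: "\<bar>x\<bar> < real n" using reals_Archimedean2 by blast
    show "x \<in> (\<Union>n. A n \<union> (\<Union>(p, q)\<in>R. B n p q))"
    proof (rule ccontr)
      assume "x \<notin> (\<Union>n. A n \<union> (\<Union>(p, q)\<in>R. B n p q))"
      then have *: "x \<notin> A n" "\<And>p q. (p, q) \<in> R \<Longrightarrow> x \<notin> B n p q" by auto
      from *(1) n obtain Q where "0 < Q" "\<not> steep_at f Q x" by (auto simp: A_def)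
      then have "f differentiable (at x)"
        by (rule mono_differentiable_at[OF f]) (use *(2) n in \<open>force simp: B_def R_def\<close>)
      with nd show False by simp
    qed
  qed
  ultimately show ?thesis by (rule negligible_subset)
qed

lemma AE_lborel_if_negligible:
  assumes "negligible {x::real. \<not> P x}"
  shows "AE x in lborel. P x"
proof -
  have "AE x in lebesgue. P x"
    using assms by (intro AE_I'[of "{x. \<not> P x}"]) (auto simp: negligible_iff_null_sets)
  then show ?thesis by (simp add: AE_completion_iff)
qed

text \<open>Such an \<open>f\<close> is the difference of the increasing functions \<open>f + g\<close> and \<open>g\<close>.\<close>

lemma real_differentiable_ae_if_dominated_by_mono:
  fixes f g :: "real \<Rightarrow> real"
  assumes dom: "\<And>x y. x \<le> y \<Longrightarrow> \<bar>f y - f x\<bar> \<le> g y - g x"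
  shows "AE u in lborel. f differentiable (at u)"
proof -
  have "mono g" using dom by (intro monoI) (smt (verit))
  moreover have "mono (\<lambda>u. f u + g u)" using dom by (intro monoI) (smt (verit))
  ultimately have "AE u in lborel. g differentiable (at u) \<and> (\<lambda>u. f u + g u) differentiable (at u)"
    by (intro AE_conjI AE_lborel_if_negligible mono_differentiable_ae)
  then show ?thesis
  proof eventually_elim
    case (elim u)
    then have "(\<lambda>u. (f u + g u) - g u) differentiable (at u)" by (intro differentiable_diff conjunct1[OF elim] conjunct2[OF elim])
    then show ?case by simp
  qed
qed

text \<open>The function \<open>a(u) + M u\<close> is increasing.\<close>

lemma lipschitz_differentiable_ae:
  fixes a :: "real \<Rightarrow> real"
  assumes lip: "\<And>u v. \<bar>a u - a v\<bar> \<le> M * \<bar>u - v\<bar>"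
  shows "AE u in lborel. a differentiable (at u)"
proof -
  have "mono (\<lambda>u. a u + M * u)"
  proof (rule monoI)
    fix u v :: real assume "u \<le> v"
    then show "a u + M * u \<le> a v + M * v" using lip[of u v] by (simp add: abs_le_iff algebra_simps)
  qed
  then have "AE u in lborel. (\<lambda>u. a u + M * u) differentiable (at u)"
    by (intro AE_lborel_if_negligible mono_differentiable_ae)
  then show ?thesis
  proof (rule AE_mp, intro AE_I2 impI)
    fix u assume "(\<lambda>u. a u + M * u) differentiable (at u)"
    then have "(\<lambda>u. (a u + M * u) - M * u) differentiable (at u)"
      by (intro differentiable_diff) auto
    then show "a differentiable (at u)" by simp
  qed
qed

section \<open>The domain above a Lipschitz graph\<close>

definition closed_upper_domain :: "(real \<Rightarrow> real) \<Rightarrow> complex set" where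
  "closed_upper_domain a = {w. a (Re w) \<le> Im w}"

lemma lipschitz_imp_continuous:
  fixes a :: "real \<Rightarrow> real"
  assumes lip: "\<And>u v. \<bar>a u - a v\<bar> \<le> M * \<bar>u - v\<bar>"
  shows "continuous_on S a"
proof -
  have "0 \<le> M" using lip[of 1 0] by auto
  then have "M-lipschitz_on S a"
    using lip by (intro lipschitz_onI) (auto simp: dist_real_def)
  then show ?thesis by (rule lipschitz_on_continuous_on)
qed

lemma open_upper_domain:
  assumes "continuous_on UNIV a"
  shows "open (upper_domain a)"
proof -
  have "continuous_on UNIV (\<lambda>w. a (Re w))"
    by (rule continuous_on_compose2[OF assms]) (auto intro: continuous_intros)
  then show ?thesis unfolding upper_domain_def
    by (intro open_Collect_less continuous_intros) auto
qed

lemma closed_closed_upper_domain: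
  assumes "continuous_on UNIV a"
  shows "closed (closed_upper_domain a)"
proof -
  have "continuous_on UNIV (\<lambda>w. a (Re w))"
    by (rule continuous_on_compose2[OF assms]) (auto intro: continuous_intros)
  then show ?thesis unfolding closed_upper_domain_def
    by (intro closed_Collect_le continuous_intros) auto
qed

text \<open>The shear \<open>z \<mapsto> z + \<i> a(Re z)\<close> maps the upper half plane homeomorphically onto the domain.\<close>

lemma simply_connected_upper_domain:
  assumes cont: "continuous_on UNIV a"
  shows "simply_connected (upper_domain a)"
proof -
  let ?H = "{z::complex. 0 < Im z}"
  have ca: "continuous_on S (\<lambda>w. a (Re w))" for S
    by (rule continuous_on_compose2[OF cont]) (auto intro: continuous_intros)
  have "?H homeomorphic upper_domain a"
    unfolding homeomorphic_def homeomorphism_def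
  proof (rule exI[of _ "\<lambda>z. z + \<i> * complex_of_real (a (Re z))"],
      rule exI[of _ "\<lambda>z. z - \<i> * complex_of_real (a (Re z))"], intro conjI ballI)
    show "(\<lambda>z. z + \<i> * complex_of_real (a (Re z))) ` ?H = upper_domain a"
    proof (intro equalityI subsetI)
      fix z assume "z \<in> upper_domain a"
      then show "z \<in> (\<lambda>z. z + \<i> * complex_of_real (a (Re z))) ` ?H"
        by (intro image_eqI[of _ _ "z - \<i> * complex_of_real (a (Re z))"]) (auto simp: upper_domain_def)
    qed (auto simp: upper_domain_def)
    show "(\<lambda>z. z - \<i> * complex_of_real (a (Re z))) ` upper_domain a = ?H"
    proof (intro equalityI subsetI)
      fix z assume "z \<in> ?H"
      then show "z \<in> (\<lambda>z. z - \<i> * complex_of_real (a (Re z))) ` upper_domain a"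
        by (intro image_eqI[of _ _ "z + \<i> * complex_of_real (a (Re z))"]) (auto simp: upper_domain_def)
    qed (auto simp: upper_domain_def)
  qed (auto intro!: continuous_intros ca)
  moreover have "simply_connected ?H"
    by (intro convex_imp_simply_connected convex_halfspace_Im_gt)
  ultimately show ?thesis using homeomorphic_simply_connected_eq by blast
qed

lemma primitive_on_upper_domain:
  assumes cont: "continuous_on UNIV a" and hol: "F holomorphic_on upper_domain a"
  obtains \<Phi> where "\<And>z. z \<in> upper_domain a \<Longrightarrow> (\<Phi> has_field_derivative F z) (at z)"
  using simply_connected_upper_domain[OF cont] hol
    simply_connected_eq_global_primitive[OF open_upper_domain[OF cont]] by blast

section \<open>Arc length\<close>

text \<open>The Cauchy criterion expresses differentiability without the value of the derivative. For fixed \<open>k\<close>,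
\<open>n\<close>, \<open>h\<close> and \<open>h'\<close> its condition is closed in \<open>u\<close> when \<open>a\<close> is continuous, which gives the Borel
measurability below.\<close>

lemma real_differentiable_iff_quotient_Cauchy:
  fixes a :: "real \<Rightarrow> real"
  shows "a differentiable (at u) \<longleftrightarrow>
    (\<forall>k::nat. \<exists>n::nat. \<forall>h h'. h \<noteq> 0 \<and> \<bar>h\<bar> < 1 / real (Suc n) \<and> h' \<noteq> 0 \<and> \<bar>h'\<bar> < 1 / real (Suc n) \<longrightarrow>
       \<bar>(a (u + h) - a u) / h - (a (u + h') - a u) / h'\<bar> \<le> 1 / real (Suc k))"
    (is "_ \<longleftrightarrow> ?R")
proof -
  define q where "q h = (a (u + h) - a u) / h" for h
  have 1: "a differentiable (at u) \<longleftrightarrow> (\<exists>l. (q \<longlongrightarrow> l) (at 0))"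
    unfolding real_differentiable_def DERIV_def q_def by simp
  have "(\<exists>l. (q \<longlongrightarrow> l) (at 0)) \<longleftrightarrow> ?R"
  proof
    assume "\<exists>l. (q \<longlongrightarrow> l) (at 0)"
    then obtain l where l: "(q \<longlongrightarrow> l) (at 0)" by blast
    show ?R
    proof
      fix k :: nat
      define e where "e = 1 / real (Suc k)"
      have "0 < e / 2" by (simp add: e_def)
      then obtain \<delta> where d: "\<delta> > 0" "\<And>h. h \<noteq> 0 \<Longrightarrow> \<bar>h\<bar> < \<delta> \<Longrightarrow> \<bar>q h - l\<bar> < e / 2"
        using LIM_D[OF l] by (metis diff_zero real_norm_def)
      obtain n :: nat where n: "1 / real (Suc n) < \<delta>" using d(1) nat_approx_posE by blast
      have "\<bar>q h - q h'\<bar> \<le> e"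
        if "h \<noteq> 0 \<and> \<bar>h\<bar> < 1 / real (Suc n) \<and> h' \<noteq> 0 \<and> \<bar>h'\<bar> < 1 / real (Suc n)" for h h'
      proof -
        have "\<bar>q h - l\<bar> < e / 2" "\<bar>q h' - l\<bar> < e / 2"
          using that n by (intro d(2); linarith)+
        then show ?thesis by linarith
      qed
      then show "\<exists>n::nat. \<forall>h h'. h \<noteq> 0 \<and> \<bar>h\<bar> < 1 / real (Suc n) \<and> h' \<noteq> 0 \<and> \<bar>h'\<bar> < 1 / real (Suc n) \<longrightarrow>
       \<bar>(a (u + h) - a u) / h - (a (u + h') - a u) / h'\<bar> \<le> 1 / real (Suc k)"
        unfolding q_def e_def by blast
    qed
  next
    assume R: ?R
    have "cauchy_filter (filtermap q (at 0))"
      unfolding cauchy_filter_metric_filtermap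
    proof (intro allI impI)
      fix e :: real assume "e > 0"
      then obtain k :: nat where k: "1 / real (Suc k) < e" using nat_approx_posE by blast
      obtain n where n: "\<And>h h'. h \<noteq> 0 \<and> \<bar>h\<bar> < 1 / real (Suc n) \<and> h' \<noteq> 0 \<and> \<bar>h'\<bar> < 1 / real (Suc n) \<Longrightarrow>
         \<bar>q h - q h'\<bar> \<le> 1 / real (Suc k)"
        using R unfolding q_def by blast
      show "\<exists>P. eventually P (at 0) \<and> (\<forall>x y. P x \<and> P y \<longrightarrow> dist (q x) (q y) < e)"
      proof (intro exI conjI allI impI)
        show "\<forall>\<^sub>F h in at 0. h \<noteq> 0 \<and> \<bar>h\<bar> < 1 / real (Suc n)"
          unfolding eventually_at by (intro exI[of _ "1 / real (Suc n)"]) auto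
        fix x y :: real assume "(x \<noteq> 0 \<and> \<bar>x\<bar> < 1 / real (Suc n)) \<and> (y \<noteq> 0 \<and> \<bar>y\<bar> < 1 / real (Suc n))"
        then have "\<bar>q x - q y\<bar> \<le> 1 / real (Suc k)" using n by blast
        then show "dist (q x) (q y) < e" using k by (simp add: dist_real_def)
      qed
    qed
    moreover have "complete (UNIV :: real set)" by (rule complete_UNIV)
    ultimately show "\<exists>l. (q \<longlongrightarrow> l) (at 0)"
      using complete_uniform[where S="UNIV :: real set"] by (force simp add: filterlim_def)
  qed
  with 1 show ?thesis by simp
qed

lemma borel_differentiability_points:
  fixes a :: "real \<Rightarrow> real"
  assumes cont: "continuous_on UNIV a"
  shows "{u. a differentiable (at u)} \<in> sets borel"
proof -
  define C where "C k n = {u. \<forall>h h'. h \<noteq> 0 \<and> \<bar>h\<bar> < 1 / real (Suc n) \<and> h' \<noteq> 0 \<and> \<bar>h'\<bar> < 1 / real (Suc n) \<longrightarrow>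
       \<bar>(a (u + h) - a u) / h - (a (u + h') - a u) / h'\<bar> \<le> 1 / real (Suc k)}" for k n :: nat
  have "closed (C k n)" for k n
    unfolding C_def
  proof (intro closed_Collect_all closed_Collect_imp)
    fix h h'
    have sh: "continuous_on UNIV (\<lambda>u. a (u + h))" for h
      by (rule continuous_on_compose2[OF cont]) (auto intro!: continuous_intros)
    have "continuous_on UNIV (\<lambda>u. \<bar>(a (u + h) - a u) / h - (a (u + h') - a u) / h'\<bar>)"
      unfolding divide_inverse by (intro continuous_intros sh cont)
    then show "closed {u. \<bar>(a (u + h) - a u) / h - (a (u + h') - a u) / h'\<bar> \<le> 1 / real (Suc k)}"
      by (rule closed_Collect_le) (rule continuous_on_const)
  qed (rule open_Collect_const)
  moreover have "{u. a differentiable (at u)} = (\<Inter>k. \<Union>n. C k n)"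
    unfolding real_differentiable_iff_quotient_Cauchy C_def by auto
  ultimately show ?thesis by (auto intro!: sets.countable_INT sets.countable_UN borel_closed)
qed

lemma graph_param_has_vector_derivative:
  "(graph_param a has_vector_derivative Complex 1 \<alpha>) (at u) \<longleftrightarrow> (a has_real_derivative \<alpha>) (at u)"
  unfolding graph_param_def has_vector_derivative_complex_iff
  by (auto simp: has_real_derivative_iff_has_vector_derivative)

text \<open>The density of the arc length has to be Borel measurable before any integral against it can be
unfolded. At points of differentiability the derivative is a limit of continuous difference
quotients; elsewhere \<open>vector_derivative\<close> is one and the same unspecified value.\<close>

lemma borel_measurable_speed:
  fixes a :: "real \<Rightarrow> real"
  assumes cont: "continuous_on UNIV a"
  shows "(\<lambda>u. norm (vector_derivative (graph_param a) (at u))) \<in> borel_measurable borel"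
proof -
  define D where "D = {u. a differentiable (at u)}"
  have D: "D \<in> sets borel" unfolding D_def by (rule borel_differentiability_points[OF cont])
  define c where "c = norm (SOME f'::complex. False)"
  define dq where "dq n u = (a (u + inverse (real (Suc n))) - a u) / inverse (real (Suc n))" for n u
  have eq: "norm (vector_derivative (graph_param a) (at u)) = (if u \<in> D then sqrt (1 + (lim (\<lambda>n. dq n u))\<^sup>2) else c)" for u
  proof (cases "u \<in> D")
    case True
    then obtain \<alpha> where \<alpha>: "(a has_real_derivative \<alpha>) (at u)"
      unfolding D_def real_differentiable_def by auto
    then have "vector_derivative (graph_param a) (at u) = Complex 1 \<alpha>"
      by (intro vector_derivative_at) (simp add: graph_param_has_vector_derivative)
    moreover have "(\<lambda>n. dq n u) \<longlonglongrightarrow> \<alpha>"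
    proof -
      have "filterlim (\<lambda>n. inverse (real (Suc n))) (at 0) sequentially"
        unfolding filterlim_at using LIMSEQ_inverse_real_of_nat by auto
      then show ?thesis using \<alpha> unfolding DERIV_def dq_def by (rule filterlim_compose[rotated])
    qed
    ultimately show ?thesis using True by (simp add: limI cmod_def)
  next
    case False
    have "\<not> (graph_param a has_vector_derivative f') (at u)" for f'
    proof
      assume "(graph_param a has_vector_derivative f') (at u)"
      then have "(a has_real_derivative Im f') (at u)"
        unfolding graph_param_def has_vector_derivative_complex_iff by simp
      then show False using False unfolding D_def real_differentiable_def by auto
    qed
    then show ?thesis using False by (simp add: vector_derivative_def c_def)
  qed
  have sh: "continuous_on UNIV (\<lambda>u. a (u + h))" for h
    by (rule continuous_on_compose2[OF cont]) (auto intro!: continuous_intros)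
  have "dq n \<in> borel_measurable borel" for n
    unfolding dq_def divide_inverse
    by (intro borel_measurable_continuous_onI continuous_intros sh cont)
  then have "(\<lambda>u. lim (\<lambda>n. dq n u)) \<in> borel_measurable borel"
    by (rule borel_measurable_lim_metric)
  then show ?thesis unfolding eq using D by measurable
qed

lemma graph_param_measurable:
  assumes cont: "continuous_on UNIV a"
  shows "graph_param a \<in> measurable borel (restrict_space borel (graph_curve a))"
proof (rule measurable_restrict_space2)
  have "continuous_on UNIV (graph_param a)"
    unfolding graph_param_def Complex_eq by (intro continuous_intros cont)
  then show "graph_param a \<in> borel_measurable borel" by (rule borel_measurable_continuous_onI)
qed (auto simp: graph_curve_def)

text \<open>A Borel null set of parameters has as image the part of the curve with real part in that set, which
is measurable because the parameter is the real part.\<close>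

lemma AE_arc_length_measureI:
  assumes cont: "continuous_on UNIV a"
    and AE: "AE u in lborel. P (graph_param a u)"
  shows "AE z in arc_length_measure a. P z"
proof -
  let ?\<Gamma> = "restrict_space borel (graph_curve a)"
  let ?d = "density lborel (\<lambda>u. ennreal (norm (vector_derivative (graph_param a) (at u))))"
  obtain N where N: "{u. \<not> P (graph_param a u)} \<subseteq> N" "N \<in> sets borel" "emeasure lborel N = 0"
    using AE by (auto elim!: AE_E)
  have meas: "graph_param a \<in> measurable ?d ?\<Gamma>"
    using graph_param_measurable[OF cont] by (simp cong: measurable_cong_sets)
  have speed: "(\<lambda>u. ennreal (norm (vector_derivative (graph_param a) (at u)))) \<in> borel_measurable lborel"
    using borel_measurable_speed[OF cont] by simp
  have "Re -` (- N) \<in> sets borel"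
    using N(2) measurable_sets[of Re borel borel "- N"] by simp
  then have "{z \<in> space ?\<Gamma>. Re z \<notin> N} \<in> sets ?\<Gamma>"
    unfolding sets_restrict_space by (auto simp: space_restrict_space image_iff intro!: bexI[of _ "Re -` (- N)"])
  then have "(AE z in distr ?d ?\<Gamma> (graph_param a). Re z \<notin> N) \<longleftrightarrow> (AE u in ?d. Re (graph_param a u) \<notin> N)"
    by (rule AE_distr_iff[OF meas])
  moreover have "AE u in lborel. u \<notin> N" using N by (intro AE_not_in) auto
  then have "AE u in ?d. Re (graph_param a u) \<notin> N"
    unfolding AE_density[OF speed] by (auto simp: graph_param_def)
  ultimately have "AE z in arc_length_measure a. Re z \<notin> N"
    unfolding arc_length_measure_def by simp
  then show ?thesis
  proof (rule AE_mp, intro AE_I2 impI)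
    fix z assume "z \<in> space (arc_length_measure a)" "Re z \<notin> N"
    then obtain u where "z = graph_param a u"
      by (auto simp: arc_length_measure_def space_restrict_space graph_curve_def)
    then show "P z" using N(1) \<open>Re z \<notin> N\<close> by (auto simp: graph_param_def)
  qed
qed

text \<open>The arc length density is at least 1 almost everywhere, so the Hardy norm also controls the integrals
with respect to the parameter.\<close>

lemma hardy_space_line_bound:
  assumes lip: "\<And>u v. \<bar>a u - a v\<bar> \<le> M * \<bar>u - v\<bar>"
    and F: "F \<in> hardy_space a p"
  obtains K :: real where "0 \<le> K"
    "\<And>\<tau>. \<tau> > 0 \<Longrightarrow> (\<integral>\<^sup>+ u. ennreal (norm (F (graph_param a u + \<i> * complex_of_real \<tau>)) powr p) \<partial>lborel) \<le> ennreal K"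
proof -
  let ?\<Gamma> = "restrict_space borel (graph_curve a)"
  let ?v = "\<lambda>u. ennreal (norm (vector_derivative (graph_param a) (at u)))"
  let ?g = "\<lambda>\<tau> z. ennreal (norm (F (z + \<i> * complex_of_real \<tau>)) powr p)"
  have cont: "continuous_on UNIV a" by (rule lipschitz_imp_continuous[OF lip])
  define S where "S = (SUP \<tau>\<in>{0<..}. \<integral>\<^sup>+ z. ?g \<tau> z \<partial>arc_length_measure a)"
  have hol: "F holomorphic_on upper_domain a" and "S < \<infinity>"
    using F by (auto simp: hardy_space_def S_def)
  then obtain K where K: "0 \<le> K" "S = ennreal K" by (cases S) auto
  have meas: "graph_param a \<in> measurable (density lborel ?v) ?\<Gamma>"
    using graph_param_measurable[OF cont] by (simp cong: measurable_cong_sets)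
  have speed: "?v \<in> borel_measurable lborel" using borel_measurable_speed[OF cont] by simp
  have speed_ge: "AE u in lborel. 1 \<le> ?v u"
    using lipschitz_differentiable_ae[OF lip]
  proof (rule AE_mp, intro AE_I2 impI)
    fix u assume "a differentiable (at u)"
    then obtain \<alpha> where "(a has_real_derivative \<alpha>) (at u)"
      unfolding real_differentiable_def by auto
    then have "vector_derivative (graph_param a) (at u) = Complex 1 \<alpha>"
      by (intro vector_derivative_at) (simp add: graph_param_has_vector_derivative)
    then have "1 \<le> norm (vector_derivative (graph_param a) (at u))" by (simp add: cmod_def)
    then show "1 \<le> ?v u" by simp
  qed
  have "(\<integral>\<^sup>+ u. ?g \<tau> (graph_param a u) \<partial>lborel) \<le> ennreal K" if \<tau>: "\<tau> > 0" for \<tau>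
  proof -
    have sub: "(\<lambda>z. z + \<i> * complex_of_real \<tau>) ` graph_curve a \<subseteq> upper_domain a"
      using \<tau> by (auto simp: graph_curve_def graph_param_def upper_domain_def)
    have "continuous_on (graph_curve a) (\<lambda>z. F (z + \<i> * complex_of_real \<tau>))"
      by (rule continuous_on_compose2[OF holomorphic_on_imp_continuous_on[OF hol] _ sub]) (intro continuous_intros)
    then have "(\<lambda>z. F (z + \<i> * complex_of_real \<tau>)) \<in> borel_measurable ?\<Gamma>"
      by (rule borel_measurable_continuous_on_restrict)
    then have g: "?g \<tau> \<in> borel_measurable ?\<Gamma>" by measurable
    have gl: "(\<lambda>u. ?g \<tau> (graph_param a u)) \<in> borel_measurable lborel"
      using measurable_compose[OF graph_param_measurable[OF cont] g] by simp
    have "(\<integral>\<^sup>+ u. ?g \<tau> (graph_param a u) \<partial>lborel) \<le> (\<integral>\<^sup>+ u. ?v u * ?g \<tau> (graph_param a u) \<partial>lborel)"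
      using speed_ge
    proof (intro nn_integral_mono_AE, elim AE_mp, intro AE_I2 impI)
      fix u assume "1 \<le> ?v u"
      then have "1 * ?g \<tau> (graph_param a u) \<le> ?v u * ?g \<tau> (graph_param a u)" by (intro mult_right_mono) auto
      then show "?g \<tau> (graph_param a u) \<le> ?v u * ?g \<tau> (graph_param a u)" by simp
    qed
    also have "\<dots> = (\<integral>\<^sup>+ u. ?g \<tau> (graph_param a u) \<partial>density lborel ?v)"
      by (rule nn_integral_density[symmetric, OF speed gl])
    also have "\<dots> = (\<integral>\<^sup>+ z. ?g \<tau> z \<partial>arc_length_measure a)"
      unfolding arc_length_measure_def using g by (intro nn_integral_distr[symmetric] meas) simp
    also have "\<dots> \<le> S" unfolding S_def using \<tau> by (intro SUP_upper) auto
    finally show ?thesis using K by simp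
  qed
  then show thesis using that K(1) by blast
qed

section \<open>A Phragmen-Lindelof principle at a boundary point\<close>

text \<open>A region above a Lipschitz graph omits a cone around the downward direction at each boundary point.
On the complement of this cone the square root of \<open>- \<i> w\<close>, with its cut along the downward ray,
stays in a sector strictly inside the right half plane.\<close>

lemma Re_csqrt_lower_bound:
  assumes M: "0 \<le> M"
  obtains \<kappa> where "\<kappa> > 0" "\<And>w. - (M * \<bar>Re w\<bar>) \<le> Im w \<Longrightarrow> \<kappa> * sqrt (norm w) \<le> Re (csqrt (- \<i> * w))"
proof -
  define c where "c = M / sqrt (1 + M\<^sup>2)"
  have sq: "sqrt (1 + M\<^sup>2) > M" using M by (intro real_less_rsqrt) auto
  have "0 < sqrt (1 + M\<^sup>2)" using M sq by linarith
  then have c: "0 \<le> c" "c < 1" using M sq by (auto simp: c_def pos_divide_less_eq)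
  have c2: "c\<^sup>2 * (1 + M\<^sup>2) = M\<^sup>2"
  proof -
    have "0 < 1 + M\<^sup>2" by (simp add: add_pos_nonneg)
    then show ?thesis by (simp add: c_def power_divide)
  qed
  define \<kappa> where "\<kappa> = sqrt ((1 - c) / 2)"
  show thesis
  proof (rule that[of \<kappa>])
    show "\<kappa> > 0" using c by (simp add: \<kappa>_def)
    fix w assume w: "- (M * \<bar>Re w\<bar>) \<le> Im w"
    have "- Im w \<le> c * norm w"
    proof (cases "Im w \<ge> 0")
      case True
      then show ?thesis using c by (smt (verit) mult_nonneg_nonneg norm_ge_zero)
    next
      case False
      then have "\<bar>Im w\<bar> \<le> M * \<bar>Re w\<bar>" using w by simp
      then have "\<bar>Im w\<bar>\<^sup>2 \<le> (M * \<bar>Re w\<bar>)\<^sup>2" by (rule power_mono) simp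
      then have "(Im w)\<^sup>2 \<le> M\<^sup>2 * (Re w)\<^sup>2" by (simp add: power_mult_distrib)
      then have "(Im w)\<^sup>2 * (1 + M\<^sup>2) \<le> M\<^sup>2 * ((Re w)\<^sup>2 + (Im w)\<^sup>2)" by (simp add: algebra_simps)
      also have "\<dots> = (c * norm w)\<^sup>2 * (1 + M\<^sup>2)"
        using c2 by (simp add: power_mult_distrib cmod_power2 mult_ac)
      finally have "(- Im w)\<^sup>2 \<le> (c * norm w)\<^sup>2"
        by (smt (verit) mult_le_cancel_right power2_minus zero_le_power2)
      then show ?thesis using c by (intro power2_le_imp_le[of "- Im w"]) auto
    qed
    then have "(1 - c) / 2 * norm w \<le> (norm w + Im w) / 2" by (simp add: algebra_simps)
    then have "sqrt ((1 - c) / 2 * norm w) \<le> sqrt ((norm w + Im w) / 2)" by (rule real_sqrt_le_mono)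
    then show "\<kappa> * sqrt (norm w) \<le> Re (csqrt (- \<i> * w))"
      by (simp add: \<kappa>_def real_sqrt_mult[symmetric] norm_mult)
  qed
qed

lemma exp_inverse_sqrt_decay:
  fixes C k :: real
  assumes "0 < C" "0 < k"
  shows "((\<lambda>r. C / r * exp (- (k / sqrt r))) \<longlongrightarrow> 0) (at_right 0)"
  using assms by real_asymp

text \<open>The maximum principle is applied to \<open>\<Psi>(z) / (z - z0)\<close>, which is small on the boundary curve near \<open>z0\<close>
but might be unbounded at \<open>z0\<close> and is merely bounded on the rest of the boundary of a small
half-disc-like region. Two exponential factors repair this. With \<open>s(z) = sqrt(- \<i> (z - z0))\<close>, whose
real part is comparable to \<open>sqrt |z - z0|\<close>, the factor \<open>exp(- \<eta> / s)\<close> kills the growth \<open>1 / |z - z0|\<close> at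
\<open>z0\<close> and disappears as \<open>\<eta> \<rightarrow> 0\<close>, while \<open>exp(- A s)\<close> makes the function small on the circular arc and
tends to 1 at \<open>z0\<close>.\<close>

lemma Phragmen_Lindelof_at_boundary_point:
  fixes a :: "real \<Rightarrow> real" and \<Psi> :: "complex \<Rightarrow> complex"
  assumes lip: "\<And>u v. \<bar>a u - a v\<bar> \<le> M * \<bar>u - v\<bar>"
    and z0: "Im z0 = a (Re z0)"
    and hol: "\<Psi> holomorphic_on upper_domain a"
    and cont: "continuous_on (closed_upper_domain a) \<Psi>"
    and bdry: "\<And>\<epsilon>. \<epsilon> > 0 \<Longrightarrow> \<exists>\<rho>>0. \<forall>z. Im z = a (Re z) \<longrightarrow> norm (z - z0) \<le> \<rho> \<longrightarrow> norm (\<Psi> z) \<le> \<epsilon> * norm (z - z0)"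
    and "\<epsilon> > 0"
  shows "\<exists>\<delta>>0. \<forall>z\<in>upper_domain a. norm (z - z0) < \<delta> \<longrightarrow> norm (\<Psi> z) \<le> \<epsilon> * norm (z - z0)"
proof -
  have M: "0 \<le> M" using lip[of 1 0] by auto
  have cont_a: "continuous_on UNIV a" by (rule lipschitz_imp_continuous[OF lip])
  obtain \<kappa> where \<kappa>: "\<kappa> > 0" "\<And>w. - (M * \<bar>Re w\<bar>) \<le> Im w \<Longrightarrow> \<kappa> * sqrt (norm w) \<le> Re (csqrt (- \<i> * w))"
    using Re_csqrt_lower_bound[OF M] by blast
  define s where "s z = csqrt (- \<i> * (z - z0))" for z
  define X where "X = closed_upper_domain a"
  have sub: "upper_domain a \<subseteq> X" by (auto simp: X_def upper_domain_def closed_upper_domain_def)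
  have cone: "- (M * \<bar>Re (z - z0)\<bar>) \<le> Im (z - z0)" if "z \<in> X" for z
    using that lip[of "Re z" "Re z0"] z0 unfolding X_def closed_upper_domain_def by auto
  have Re_s: "\<kappa> * sqrt (norm (z - z0)) \<le> Re (s z)" if "z \<in> X" for z
    unfolding s_def by (rule \<kappa>(2)[OF cone[OF that]])
  have norm_s: "(norm (s z))\<^sup>2 = norm (z - z0)" for z
    by (simp add: s_def norm_power[symmetric] norm_mult)
  have Re_s_pos: "Re (s z) > 0" if "z \<in> X" "z \<noteq> z0" for z
    using Re_s[OF that(1)] \<kappa>(1) that(2) by (smt (verit) mult_pos_pos real_sqrt_gt_zero right_minus_eq zero_less_norm_iff)
  have Re_s_le: "Re (s z) \<le> sqrt (norm (z - z0))" for z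
    using complex_Re_le_cmod[of "s z"] norm_s[of z] by (metis norm_ge_zero real_sqrt_unique)
  have Re_inv: "\<kappa> / sqrt (norm (z - z0)) \<le> Re (1 / s z)" if "z \<in> X" "z \<noteq> z0" for z
  proof -
    have n: "norm (z - z0) > 0" using that by simp
    have "\<kappa> / sqrt (norm (z - z0)) = \<kappa> * sqrt (norm (z - z0)) / norm (z - z0)"
      using n by (simp add: field_simps)
    also have "\<dots> \<le> Re (s z) / norm (z - z0)"
      using Re_s[OF that(1)] n by (intro divide_right_mono) auto
    also have "\<dots> = Re (1 / s z)"
      by (simp add: norm_s[symmetric] cmod_power2 Re_divide)
    finally show ?thesis .
  qed
  have s_not_neg: "- \<i> * (z - z0) \<notin> \<real>\<^sub>\<le>\<^sub>0" if "z \<in> X" "z \<noteq> z0" for z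
  proof
    assume "- \<i> * (z - z0) \<in> \<real>\<^sub>\<le>\<^sub>0"
    then have "Re (z - z0) = 0" "Im (z - z0) \<le> 0" by (auto simp: complex_nonpos_Reals_iff)
    with cone[OF that(1)] have "z - z0 = 0" by (simp add: complex_eq_iff)
    with that show False by simp
  qed
  obtain \<rho> where \<rho>: "\<rho> > 0"
    "\<And>z. Im z = a (Re z) \<Longrightarrow> norm (z - z0) \<le> \<rho> \<Longrightarrow> norm (\<Psi> z) \<le> \<epsilon> / 2 * norm (z - z0)"
    using bdry[of "\<epsilon> / 2"] \<open>\<epsilon> > 0\<close> by auto
  define Y where "Y = X \<inter> cball z0 \<rho>"
  have clX: "closed X" unfolding X_def by (rule closed_closed_upper_domain[OF cont_a])
  have "compact Y" unfolding Y_def using clX by (simp add: compact_cball closed_Int_compact)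
  moreover have "continuous_on Y \<Psi>" using cont unfolding Y_def X_def by (rule continuous_on_subset) auto
  ultimately have "bounded (\<Psi> ` Y)" by (intro compact_imp_bounded compact_continuous_image)
  then obtain C where C: "C > 0" "\<And>z. z \<in> Y \<Longrightarrow> norm (\<Psi> z) \<le> C"
    by (auto simp: bounded_pos)
  \<comment> \<open>On the arc \<open>|z - z0| = \<rho>\<close> this gives \<open>A Re s \<ge> t\<close> with \<open>t = C / (\<rho> \<epsilon> / 2)\<close>, and \<open>exp(- t) \<le> 1 / t\<close> reduces the
      bound \<open>C / \<rho>\<close> to \<open>\<epsilon> / 2\<close>.\<close>
  define A where "A = C / (\<rho> * (\<epsilon> / 2)) / (\<kappa> * sqrt \<rho>)"
  have A: "A > 0" using C \<rho> \<kappa> \<open>\<epsilon> > 0\<close> by (simp add: A_def)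
  define S where "S = upper_domain a \<inter> ball z0 \<rho>"
  have openS: "open S" unfolding S_def by (intro open_Int open_upper_domain cont_a open_ball)
  have S_sub: "S \<subseteq> Y" using sub by (auto simp: S_def Y_def)
  have clS: "closure S \<subseteq> Y"
    by (rule closure_minimal[OF S_sub]) (simp add: Y_def closed_Int clX)
  have z0_S: "z \<noteq> z0" if "z \<in> S" for z
    using that z0 by (auto simp: S_def upper_domain_def)
  have main: "norm (\<Psi> z) / norm (z - z0) * exp (- (A * Re (s z)) - \<eta> * Re (1 / s z)) \<le> \<epsilon> / 2"
    if "z \<in> S" "\<eta> > 0" for z \<eta>
  proof -
    define G0 where "G0 z = \<Psi> z / (z - z0) * exp (- (of_real A * s z) - of_real \<eta> * (1 / s z))" for z
    define G where "G z = (if z = z0 then 0 else G0 z)" for z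
    have norm_G0: "norm (G0 z) = norm (\<Psi> z) / norm (z - z0) * exp (- (A * Re (s z)) - \<eta> * Re (1 / s z))" for z
    proof -
      have "Re (of_real \<eta> * (1 / s z)) = \<eta> * Re (1 / s z)" by (simp only: times_complex.sel Re_complex_of_real Im_complex_of_real mult_zero_left diff_zero) 
      then show ?thesis unfolding G0_def norm_mult norm_divide norm_exp_eq_Re by simp
    qed
    have exp_le: "exp (- (A * Re (s z)) - \<eta> * Re (1 / s z)) \<le> exp (- (\<eta> * \<kappa> / sqrt (norm (z - z0))))"
      if "z \<in> X" "z \<noteq> z0" for z
    proof -
      have "\<eta> * (\<kappa> / sqrt (norm (z - z0))) \<le> \<eta> * Re (1 / s z)"
        using Re_inv[OF that] \<open>\<eta> > 0\<close> by (intro mult_left_mono) auto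
      moreover have "A * Re (s z) \<ge> 0" using A Re_s_pos[OF that] by simp
      ultimately show ?thesis by simp
    qed
    have s_nz: "s z \<noteq> 0" if "z \<in> X" "z \<noteq> z0" for z
      using Re_s_pos[OF that] by auto
    have s_cont: "continuous_on (Y - {z0}) s"
      unfolding s_def
    proof (intro continuous_at_imp_continuous_on ballI isCont_csqrt')
      fix z assume "z \<in> Y - {z0}"
      then show "- \<i> * (z - z0) \<notin> \<real>\<^sub>\<le>\<^sub>0" by (intro s_not_neg) (auto simp: Y_def)
    qed (intro continuous_intros)
    have G0_cont: "continuous_on (Y - {z0}) G0"
      unfolding G0_def using s_nz
      by (intro continuous_intros s_cont continuous_on_subset[OF \<open>continuous_on Y \<Psi>\<close>]) (auto simp: Y_def)
    have lim0: "(G \<longlongrightarrow> 0) (at z0 within Y)"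
    proof (rule Lim_null_comparison)
      have k: "\<eta> * \<kappa> > 0" using \<open>\<eta> > 0\<close> \<kappa>(1) by simp
      have "((\<lambda>r. C / r * exp (- (\<eta> * \<kappa> / sqrt r))) \<longlongrightarrow> 0) (at_right 0)"
        by (rule exp_inverse_sqrt_decay[OF C(1) k])
      moreover have "filterlim (\<lambda>z. norm (z - z0)) (at_right 0) (at z0 within Y)"
        unfolding filterlim_at
        by (auto simp: eventually_at_filter intro!: tendsto_eq_intros)
      ultimately show "((\<lambda>z. C / norm (z - z0) * exp (- (\<eta> * \<kappa> / sqrt (norm (z - z0))))) \<longlongrightarrow> 0) (at z0 within Y)"
        by (rule filterlim_compose)
      have "norm (G z) \<le> C / norm (z - z0) * exp (- (\<eta> * \<kappa> / sqrt (norm (z - z0))))"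
        if "z \<in> Y" "z \<noteq> z0" for z
        unfolding G_def using that norm_G0[of z] exp_le[of z] C(2)[of z] C(1)
        by (auto simp: Y_def intro!: mult_mono divide_right_mono)
      then show "\<forall>\<^sub>F z in at z0 within Y. norm (G z) \<le> C / norm (z - z0) * exp (- (\<eta> * \<kappa> / sqrt (norm (z - z0))))"
        by (auto simp: eventually_at_filter)
    qed
    have G_cont: "continuous_on Y G"
      unfolding continuous_on_def
    proof
      fix z assume z: "z \<in> Y"
      show "(G \<longlongrightarrow> G z) (at z within Y)"
      proof (cases "z = z0")
        case True then show ?thesis using lim0 by (simp add: G_def)
      next
        case False
        have "continuous_on (Y - {z0}) G"
          using G0_cont by (rule continuous_on_eq) (auto simp: G_def)
        then have "(G \<longlongrightarrow> G z) (at z within (Y - {z0}))"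
          using z False unfolding continuous_on_def by auto
        moreover have "at z within (Y - {z0}) = at z within Y"
          using False by (intro at_within_nhd[of z "- {z0}"]) auto
        ultimately show ?thesis by simp
      qed
    qed
    have G_hol: "G holomorphic_on S"
    proof (rule holomorphic_transform)
      have "s holomorphic_on S"
        unfolding s_def
      proof (intro holomorphic_on_csqrt')
        show "- \<i> * (z - z0) \<notin> \<real>\<^sub>\<le>\<^sub>0" if "z \<in> S" for z
          using that S_sub z0_S by (intro s_not_neg) (auto simp: Y_def)
      qed (intro holomorphic_intros)
      then show "G0 holomorphic_on S"
        unfolding G0_def using s_nz S_sub z0_S
        by (intro holomorphic_intros holomorphic_on_subset[OF hol]) (auto simp: Y_def S_def)
      show "\<And>z. z \<in> S \<Longrightarrow> G0 z = G z" using z0_S by (auto simp: G_def)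
    qed
    have "norm (G z) \<le> \<epsilon> / 2"
    proof (rule maximum_modulus_frontier[of G S])
      show "G holomorphic_on interior S" using G_hol openS by (simp add: interior_open)
      show "continuous_on (closure S) G" by (rule continuous_on_subset[OF G_cont clS])
      show "bounded S" by (rule bounded_subset[of "ball z0 \<rho>"]) (auto simp: S_def)
      show "z \<in> S" by fact
      fix x assume "x \<in> frontier S"
      then have x: "x \<in> Y" "x \<notin> S"
        using clS openS by (auto simp: frontier_def interior_open)
      show "norm (G x) \<le> \<epsilon> / 2"
      proof (cases "x = z0")
        case True then show ?thesis using \<open>\<epsilon> > 0\<close> by (simp add: G_def)
      next
        case False
        then have xn: "norm (x - z0) > 0" by simp
        have xX: "x \<in> X" using x by (simp add: Y_def)
        have i0: "\<eta> * Re (1 / s x) \<ge> 0"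
          using Re_inv[OF xX False] \<kappa>(1) \<open>\<eta> > 0\<close>
          by (smt (verit) divide_nonneg_nonneg mult_nonneg_nonneg norm_ge_zero real_sqrt_ge_zero)
        show ?thesis
        proof (cases "Im x = a (Re x)")
          case True
          have "norm (\<Psi> x) \<le> \<epsilon> / 2 * norm (x - z0)"
            using x True by (intro \<rho>(2)) (auto simp: Y_def dist_norm norm_minus_commute)
          then have 1: "norm (\<Psi> x) / norm (x - z0) \<le> \<epsilon> / 2" using xn by (simp add: divide_le_eq)
          have "A * Re (s x) \<ge> 0" using A Re_s_pos[OF xX False] by simp
          then have 2: "exp (- (A * Re (s x)) - \<eta> * Re (1 / s x)) \<le> 1"
            using i0 by simp
          have "norm (G0 x) \<le> \<epsilon> / 2 * 1"
            unfolding norm_G0 using 1 2 \<open>\<epsilon> > 0\<close> by (intro mult_mono) auto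
          then show ?thesis using False by (simp add: G_def)
        next
          case neq: False
          then have "x \<in> upper_domain a"
            using xX by (auto simp: X_def closed_upper_domain_def upper_domain_def)
          then have xr: "norm (x - z0) = \<rho>"
            using x by (auto simp: S_def Y_def dist_norm norm_minus_commute)
          define t where "t = C / (\<rho> * (\<epsilon> / 2))"
          have t: "t > 0" using C \<rho> \<open>\<epsilon> > 0\<close> by (simp add: t_def)
          have "t = A * (\<kappa> * sqrt \<rho>)" using \<kappa> \<rho> by (simp add: A_def t_def)
          also have "\<dots> \<le> A * Re (s x)"
            using Re_s[OF xX] A xr by (intro mult_left_mono) auto
          finally have "exp (- (A * Re (s x)) - \<eta> * Re (1 / s x)) \<le> exp (- t)" using i0 by simp
          also have "\<dots> \<le> 1 / t"
          proof -
            have "t \<le> exp t" using exp_ge_add_one_self[of t] by linarith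
            then show ?thesis using t by (simp add: exp_minus field_simps)
          qed
          finally have 2: "exp (- (A * Re (s x)) - \<eta> * Re (1 / s x)) \<le> 1 / t" .
          have 1: "norm (\<Psi> x) / norm (x - z0) \<le> C / \<rho>"
            using C(2)[OF x(1)] xr \<rho> by (simp add: divide_right_mono)
          have "norm (G0 x) \<le> C / \<rho> * (1 / t)"
            unfolding norm_G0 using 1 2 C(1) \<rho>(1) by (intro mult_mono) auto
          also have "\<dots> = \<epsilon> / 2" using C(1) \<rho>(1) by (simp add: t_def)
          finally show ?thesis using False by (simp add: G_def)
        qed
      qed
    qed
    then show ?thesis using norm_G0[of z] z0_S[OF that(1)] by (simp add: G_def)
  qed
  have bound: "norm (\<Psi> z) \<le> \<epsilon> / 2 * norm (z - z0) * exp (A * sqrt (norm (z - z0)))" if z: "z \<in> S" for z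
  proof -
    let ?q = "norm (\<Psi> z) / norm (z - z0) * exp (- (A * Re (s z)))"
    have "((\<lambda>\<eta>. norm (\<Psi> z) / norm (z - z0) * exp (- (A * Re (s z)) - \<eta> * Re (1 / s z)))
        \<longlongrightarrow> norm (\<Psi> z) / norm (z - z0) * exp (- (A * Re (s z)) - 0 * Re (1 / s z))) (at_right 0)"
      by (intro tendsto_intros)
    moreover have "\<forall>\<^sub>F \<eta> in at_right 0. norm (\<Psi> z) / norm (z - z0) * exp (- (A * Re (s z)) - \<eta> * Re (1 / s z)) \<le> \<epsilon> / 2"
      unfolding eventually_at_filter using main[OF z] by (auto intro: always_eventually)
    ultimately have "norm (\<Psi> z) / norm (z - z0) * exp (- (A * Re (s z)) - 0 * Re (1 / s z)) \<le> \<epsilon> / 2"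
      by (rule tendsto_upperbound) simp
    then have *: "?q \<le> \<epsilon> / 2" by simp
    have "norm (\<Psi> z) = ?q * (norm (z - z0) * exp (A * Re (s z)))"
      using z0_S[OF z] by (simp add: exp_minus)
    also have "\<dots> \<le> \<epsilon> / 2 * (norm (z - z0) * exp (A * sqrt (norm (z - z0))))"
      using * Re_s_le[of z] A \<open>\<epsilon> > 0\<close> by (intro mult_mono) auto
    finally show ?thesis by (simp add: mult.assoc)
  qed
  \<comment> \<open>Within this distance the remaining factor \<open>exp (A sqrt |z - z0|)\<close> is at most 2.\<close>
  define \<delta> where "\<delta> = min \<rho> ((ln 2 / A)\<^sup>2)"
  show ?thesis
  proof (intro exI conjI ballI impI)
    show "\<delta> > 0" using \<rho> A by (simp add: \<delta>_def)
    fix z assume z: "z \<in> upper_domain a" "norm (z - z0) < \<delta>"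
    then have zS: "z \<in> S" by (auto simp: S_def \<delta>_def dist_norm norm_minus_commute)
    have "sqrt (norm (z - z0)) \<le> sqrt ((ln 2 / A)\<^sup>2)"
      using z(2) by (intro real_sqrt_le_mono) (simp add: \<delta>_def)
    then have "sqrt (norm (z - z0)) \<le> ln 2 / A" using A by simp
    then have "A * sqrt (norm (z - z0)) \<le> ln 2" using A by (simp add: field_simps)
    then have "exp (A * sqrt (norm (z - z0))) \<le> exp (ln 2)" by (simp only: exp_le_cancel_iff)
    then have "exp (A * sqrt (norm (z - z0))) \<le> 2" by simp
    then have "\<epsilon> / 2 * norm (z - z0) * exp (A * sqrt (norm (z - z0))) \<le> \<epsilon> / 2 * norm (z - z0) * 2"
      using \<open>\<epsilon> > 0\<close> by (intro mult_left_mono) auto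
    then show "norm (\<Psi> z) \<le> \<epsilon> * norm (z - z0)" using bound[OF zS] by simp
  qed
qed

section \<open>From a differentiable boundary trace to a non-tangential limit\<close>

lemma sin_ge_in_sector:
  assumes "0 < \<phi>" "\<phi> < pi / 2" "\<phi> < x" "x < pi - \<phi>"
  shows "sin \<phi> \<le> sin x"
proof (cases "x \<le> pi / 2")
  case True
  then show ?thesis using assms by (intro sin_monotone_2pi_le) auto
next
  case False
  have "sin \<phi> \<le> sin (pi - x)" using False assms by (intro sin_monotone_2pi_le) auto
  then show ?thesis by simp
qed

text \<open>Near a point of differentiability the graph stays outside every sector about the normal direction, so
a point \<open>w\<close> of the sector has distance to the graph comparable to \<open>|w - z0|\<close>. Multiplication by
\<open>cis (- arctan \<alpha>)\<close> rotates the tangent to the real axis; heights above the tangent are then imaginary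
parts.\<close>

lemma cball_inside_upper_domain:
  assumes der: "(a has_real_derivative \<alpha>) (at (Re z0))" and z0: "Im z0 = a (Re z0)"
    and \<phi>: "0 < \<phi>" "\<phi> < pi / 2"
  shows "\<exists>\<delta>>0. \<forall>w\<in>nontangential_sector z0 (arctan \<alpha>) \<phi>. norm (w - z0) < \<delta> \<longrightarrow>
    cball w (sin \<phi> / 2 * norm (w - z0)) \<subseteq> upper_domain a"
proof -
  define \<sigma> where "\<sigma> = sin \<phi>"
  have \<sigma>: "0 < \<sigma>" "\<sigma> \<le> 1" unfolding \<sigma>_def using \<phi> by (auto intro: sin_gt_zero)
  have "(a has_derivative (\<lambda>h. h * \<alpha>)) (at (Re z0))"
    using der by (simp add: has_field_derivative_def mult_commute_abs)
  then obtain d where d: "d > 0"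
    "\<And>y. \<bar>y - Re z0\<bar> < d \<Longrightarrow> \<bar>a y - a (Re z0) - (y - Re z0) * \<alpha>\<bar> \<le> \<sigma> / 8 * \<bar>y - Re z0\<bar>"
    using \<sigma>(1) unfolding has_derivative_at_alt by (metis divide_pos_pos real_norm_def zero_less_numeral)
  show ?thesis
  proof (intro exI[of _ "d / 2"] conjI ballI impI subsetI)
    show "d / 2 > 0" using d by simp
    fix w z assume w: "w \<in> nontangential_sector z0 (arctan \<alpha>) \<phi>" "norm (w - z0) < d / 2"
      and "z \<in> cball w (sin \<phi> / 2 * norm (w - z0))"
    then have zw: "norm (z - w) \<le> \<sigma> / 2 * norm (w - z0)"
      by (simp add: dist_norm norm_minus_commute \<sigma>_def)
    obtain r \<theta> where r: "w = z0 + complex_of_real r * cis \<theta>" "0 < r" "\<phi> < \<theta> - arctan \<alpha>" "\<theta> - arctan \<alpha> < pi - \<phi>"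
      using w unfolding nontangential_sector_def by auto
    have nw: "norm (w - z0) = r" using r by (simp add: norm_mult)
    have eq: "(w - z0) * cis (- arctan \<alpha>) = of_real r * cis (\<theta> - arctan \<alpha>)"
      using r by (simp add: mult.assoc cis_mult)
    have "\<sigma> * r \<le> Im ((w - z0) * cis (- arctan \<alpha>))"
      unfolding eq using sin_ge_in_sector[OF \<phi> r(3,4)] r(2) by (simp add: \<sigma>_def)
    moreover have "Im ((w - z) * cis (- arctan \<alpha>)) \<le> \<sigma> / 2 * r"
    proof -
      have "Im ((w - z) * cis (- arctan \<alpha>)) \<le> norm ((w - z) * cis (- arctan \<alpha>))"
        using abs_Im_le_cmod abs_le_D1 by blast
      also have "\<dots> = norm (z - w)" by (simp add: norm_mult norm_minus_commute)
      finally show ?thesis using zw nw by simp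
    qed
    moreover have "(z - z0) * cis (- arctan \<alpha>) = (w - z0) * cis (- arctan \<alpha>) - (w - z) * cis (- arctan \<alpha>)"
      by (simp add: algebra_simps)
    ultimately have 1: "\<sigma> / 2 * r \<le> Im ((z - z0) * cis (- arctan \<alpha>))" by simp
    define x y where "x = Re (z - z0)" and "y = Im (z - z0)"
    have "Im ((z - z0) * cis (- arctan \<alpha>)) = (y - \<alpha> * x) * cos (arctan \<alpha>)"
      by (simp add: x_def y_def cos_arctan sin_arctan algebra_simps add_divide_distrib diff_divide_distrib)
    then have 2: "\<sigma> / 2 * r \<le> (y - \<alpha> * x) * cos (arctan \<alpha>)" using 1 by simp
    have c: "0 < cos (arctan \<alpha>)" "cos (arctan \<alpha>) \<le> 1"
      using arctan_lbound[of \<alpha>] arctan_ubound[of \<alpha>] by (auto intro!: cos_gt_zero_pi)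
    have "0 < \<sigma> / 2 * r" using \<sigma> r by simp
    then have "0 < y - \<alpha> * x" using 2 c by (smt (verit) mult_nonpos_nonneg)
    then have "(y - \<alpha> * x) * cos (arctan \<alpha>) \<le> (y - \<alpha> * x) * 1" using c by (intro mult_left_mono) auto
    then have 3: "\<sigma> / 2 * r \<le> y - \<alpha> * x" using 2 by simp
    have "norm (z - z0) \<le> norm (z - w) + norm (w - z0)" by (rule norm_diff_triangle_le[of z w _ z0]) auto
    also have "\<dots> \<le> 2 * r" using zw mult_right_mono[of "\<sigma> / 2" 1 r] \<sigma> r(2) unfolding nw by linarith
    finally have "\<bar>x\<bar> \<le> 2 * r" unfolding x_def using abs_Re_le_cmod order_trans by blast
    moreover have "2 * r < d" using w nw by simp
    ultimately have "\<bar>a (Re z) - a (Re z0) - x * \<alpha>\<bar> \<le> \<sigma> / 8 * \<bar>x\<bar>"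
      using d(2)[of "Re z"] by (simp add: x_def)
    also have "\<dots> \<le> \<sigma> / 8 * (2 * r)" using \<open>\<bar>x\<bar> \<le> 2 * r\<close> \<sigma> by (intro mult_left_mono) auto
    finally have "a (Re z) - a (Re z0) \<le> x * \<alpha> + \<sigma> / 4 * r" unfolding abs_le_iff by simp
    also have "\<dots> < x * \<alpha> + \<sigma> / 2 * r" using \<sigma> r by simp
    also have "\<dots> \<le> y" using 3 by (simp add: mult.commute)
    finally show "z \<in> upper_domain a" using z0 by (simp add: upper_domain_def y_def)
  qed
qed

text \<open>Subtracting the linear function with slope \<open>l\<close> from the primitive leaves \<open>\<Psi>\<close>, which is \<open>o(|z - z0|)\<close> on
the curve by the chain rule, hence in the domain by the Phragmen-Lindelof principle. The Cauchy
inequality turns this into \<open>\<Psi>' = F - l \<rightarrow> 0\<close> in sectors. Without the step into the interior one would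
have to bound a Cauchy integral of \<open>o(|z - z0|) / |z - w|\<^sup>2\<close>, which diverges logarithmically.\<close>

lemma nontangential_limit_if_primitive_differentiable:
  fixes a :: "real \<Rightarrow> real" and F \<Phi> :: "complex \<Rightarrow> complex"
  assumes lip: "\<And>u v. \<bar>a u - a v\<bar> \<le> M * \<bar>u - v\<bar>"
    and prim: "\<And>z. z \<in> upper_domain a \<Longrightarrow> (\<Phi> has_field_derivative F z) (at z)"
    and cont: "continuous_on (closed_upper_domain a) \<Phi>"
    and der_a: "(a has_real_derivative \<alpha>) (at u0)"
    and der_\<Phi>: "((\<lambda>u. \<Phi> (graph_param a u)) has_vector_derivative \<beta>) (at u0)"
  shows "has_nontangential_limit a F (graph_param a u0) (\<beta> / Complex 1 \<alpha>)"
proof -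
  define z0 where "z0 = graph_param a u0"
  define l where "l = \<beta> / Complex 1 \<alpha>"
  have nz: "Complex 1 \<alpha> \<noteq> 0" by (simp add: complex_eq_iff)
  have z0: "Re z0 = u0" "Im z0 = a (Re z0)" by (simp_all add: z0_def graph_param_def)
  have der_\<zeta>: "(graph_param a has_vector_derivative Complex 1 \<alpha>) (at u0)"
    using der_a by (simp add: graph_param_has_vector_derivative)
  define \<Psi> where "\<Psi> z = \<Phi> z - \<Phi> z0 - l * (z - z0)" for z
  have \<Psi>_der: "(\<Psi> has_field_derivative (F z - l)) (at z)" if "z \<in> upper_domain a" for z
    unfolding \<Psi>_def by (rule derivative_eq_intros prim[OF that] refl | simp)+
  have opn: "open (upper_domain a)"
    by (intro open_upper_domain lipschitz_imp_continuous[OF lip])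
  have \<Psi>_hol: "\<Psi> holomorphic_on upper_domain a"
    using \<Psi>_der opn by (auto simp: holomorphic_on_open)
  have \<Psi>_cont: "continuous_on (closed_upper_domain a) \<Psi>"
    unfolding \<Psi>_def by (intro continuous_intros cont)
  have bdry: "\<exists>\<rho>>0. \<forall>z. Im z = a (Re z) \<longrightarrow> norm (z - z0) \<le> \<rho> \<longrightarrow> norm (\<Psi> z) \<le> \<epsilon> * norm (z - z0)"
    if \<epsilon>: "\<epsilon> > 0" for \<epsilon>
  proof -
    have "((\<lambda>u. \<Psi> (graph_param a u)) has_vector_derivative (\<beta> - l * Complex 1 \<alpha>)) (at u0)"
      unfolding \<Psi>_def by (rule derivative_eq_intros der_\<Phi> der_\<zeta> refl | simp)+
    then have "((\<lambda>u. \<Psi> (graph_param a u)) has_derivative (\<lambda>h. 0)) (at u0)"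
      using nz by (simp add: has_vector_derivative_def l_def)
    then obtain d where d: "d > 0"
      "\<And>u. \<bar>u - u0\<bar> < d \<Longrightarrow> norm (\<Psi> (graph_param a u) - \<Psi> (graph_param a u0)) \<le> \<epsilon> * \<bar>u - u0\<bar>"
      using \<epsilon> unfolding has_derivative_at_alt by (auto simp: real_norm_def)
    show ?thesis
    proof (intro exI[of _ "d / 2"] conjI allI impI)
      fix z assume z: "Im z = a (Re z)" "norm (z - z0) \<le> d / 2"
      have zeq: "z = graph_param a (Re z)" using z by (simp add: graph_param_def complex_eq_iff)
      have le: "\<bar>Re z - u0\<bar> \<le> norm (z - z0)" using abs_Re_le_cmod[of "z - z0"] z0 by simp
      then have "norm (\<Psi> (graph_param a (Re z)) - \<Psi> (graph_param a u0)) \<le> \<epsilon> * \<bar>Re z - u0\<bar>"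
        using z(2) d(1) by (intro d(2)) auto
      then have "norm (\<Psi> z) \<le> \<epsilon> * \<bar>Re z - u0\<bar>"
        using zeq by (simp add: \<Psi>_def z0_def)
      also have "\<dots> \<le> \<epsilon> * norm (z - z0)" using le \<epsilon> by (intro mult_left_mono) auto
      finally show "norm (\<Psi> z) \<le> \<epsilon> * norm (z - z0)" .
    qed (use d in auto)
  qed
  have PL: "\<exists>\<delta>>0. \<forall>z\<in>upper_domain a. norm (z - z0) < \<delta> \<longrightarrow> norm (\<Psi> z) \<le> \<epsilon> * norm (z - z0)"
    if "\<epsilon> > 0" for \<epsilon>
    by (rule Phragmen_Lindelof_at_boundary_point[OF lip z0(2) \<Psi>_hol \<Psi>_cont bdry that])
  have limit: "(F \<longlongrightarrow> l) (at z0 within (nontangential_sector z0 (arctan \<alpha>) \<phi> \<inter> upper_domain a))"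
    if \<phi>: "0 < \<phi>" "\<phi> < pi / 2" for \<phi>
    unfolding Lim_within
  proof (intro allI impI)
    fix e :: real assume e: "e > 0"
    define c where "c = sin \<phi> / 2"
    have c: "0 < c" "c \<le> 1 / 2" unfolding c_def using \<phi> by (auto intro: sin_gt_zero)
    \<comment> \<open>On the circle \<open>|z - w| = c |w - z0|\<close> one has \<open>|z - z0| \<le> 2 |w - z0|\<close>, so the Cauchy inequality
      loses the factor \<open>2 / c\<close>; with \<open>e c / 4\<close> it yields \<open>e / 2\<close>.\<close>
    have "e * c / 4 > 0" using e c by simp
    then obtain \<delta>1 where d1: "\<delta>1 > 0" "\<And>z. z \<in> upper_domain a \<Longrightarrow> norm (z - z0) < \<delta>1 \<Longrightarrow> norm (\<Psi> z) \<le> e * c / 4 * norm (z - z0)"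
      using PL by blast
    obtain \<delta>2 where d2: "\<delta>2 > 0" "\<And>w. w \<in> nontangential_sector z0 (arctan \<alpha>) \<phi> \<Longrightarrow> norm (w - z0) < \<delta>2 \<Longrightarrow> cball w (c * norm (w - z0)) \<subseteq> upper_domain a"
      using cball_inside_upper_domain[of a \<alpha> z0 \<phi>] der_a z0 \<phi> unfolding c_def by auto
    show "\<exists>d>0. \<forall>w\<in>nontangential_sector z0 (arctan \<alpha>) \<phi> \<inter> upper_domain a. 0 < dist w z0 \<and> dist w z0 < d \<longrightarrow> dist (F w) l < e"
    proof (intro exI[of _ "min (\<delta>1 / 2) \<delta>2"] conjI ballI impI)
      show "0 < min (\<delta>1 / 2) \<delta>2" using d1 d2 by simp
      fix w assume w: "w \<in> nontangential_sector z0 (arctan \<alpha>) \<phi> \<inter> upper_domain a"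
        and wd: "0 < dist w z0 \<and> dist w z0 < min (\<delta>1 / 2) \<delta>2"
      define r where "r = norm (w - z0)"
      have r: "0 < r" "2 * r < \<delta>1" "r < \<delta>2" using wd by (auto simp: r_def dist_norm)
      have sub: "cball w (c * r) \<subseteq> upper_domain a" using d2(2)[of w] w r by (auto simp: r_def)
      have cr: "0 < c * r" "c * r \<le> r" using c r by auto
      have "norm ((deriv ^^ 1) \<Psi> w) \<le> fact 1 * (e * c / 4 * (2 * r)) / (c * r) ^ 1"
      proof (rule Cauchy_inequality)
        show "\<Psi> holomorphic_on ball w (c * r)"
          using \<Psi>_hol sub ball_subset_cball by (meson holomorphic_on_subset order_trans)
        show "continuous_on (cball w (c * r)) \<Psi>"
          using \<Psi>_hol sub holomorphic_on_imp_continuous_on continuous_on_subset by blast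
        fix z assume z: "norm (w - z) = c * r"
        have zin: "z \<in> upper_domain a" using z sub by (auto simp: dist_norm)
        have "norm (z - z0) \<le> norm (z - w) + norm (w - z0)" by (rule norm_diff_triangle_le[of z w _ z0]) auto
        then have zn: "norm (z - z0) \<le> 2 * r" using z cr by (simp add: r_def norm_minus_commute)
        then have "norm (\<Psi> z) \<le> e * c / 4 * norm (z - z0)" using d1(2)[OF zin] r by simp
        also have "\<dots> \<le> e * c / 4 * (2 * r)" using zn e c by (intro mult_left_mono) auto
        finally show "norm (\<Psi> z) \<le> e * c / 4 * (2 * r)" .
      qed (use cr in auto)
      moreover have "deriv \<Psi> w = F w - l" using \<Psi>_der w by (intro DERIV_imp_deriv) auto
      ultimately have "norm (F w - l) \<le> e / 2" using c r by (simp add: field_simps)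
      then show "dist (F w) l < e" using e by (simp add: dist_norm)
    qed
  qed
  have polar: "Complex 1 \<alpha> = complex_of_real (norm (Complex 1 \<alpha>)) * cis (arctan \<alpha>)"
  proof -
    have "norm (Complex 1 \<alpha>) = sqrt (1 + \<alpha>\<^sup>2)" by (simp add: cmod_def)
    moreover have "0 < sqrt (1 + \<alpha>\<^sup>2)" by (simp add: add_pos_nonneg)
    ultimately show ?thesis by (simp add: complex_eq_iff cos_arctan sin_arctan)
  qed
  show ?thesis
    unfolding has_nontangential_limit_def
    using der_\<zeta> polar limit arctan_lbound[of \<alpha>] arctan_ubound[of \<alpha>]
    by (intro exI[of _ u0] exI[of _ "Complex 1 \<alpha>"] exI[of _ "arctan \<alpha>"]) (auto simp: z0_def l_def)
qed

text \<open>The tangent is not vertical, so the vertical ray lies in every sufficiently wide sector.\<close>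

lemma upright_limit_if_nontangential_limit:
  assumes "has_nontangential_limit a F z0 l"
  shows "upright_limit F z0 = l"
proof -
  obtain u0 \<phi>0 where z0: "z0 = graph_param a u0" and \<phi>0: "- pi / 2 < \<phi>0" "\<phi>0 < pi / 2"
    and lim: "\<And>\<phi>. 0 < \<phi> \<Longrightarrow> \<phi> < pi / 2 \<Longrightarrow> (F \<longlongrightarrow> l) (at z0 within (nontangential_sector z0 \<phi>0 \<phi> \<inter> upper_domain a))"
    using assms unfolding has_nontangential_limit_def by auto
  define \<phi> where "\<phi> = (pi / 2 - \<bar>\<phi>0\<bar>) / 2"
  have \<phi>: "0 < \<phi>" "\<phi> < pi / 2" "\<phi> < pi / 2 - \<phi>0" "pi / 2 - \<phi>0 < pi - \<phi>"
  proof -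
    have *: "\<bar>\<phi>0\<bar> < pi / 2" "- \<bar>\<phi>0\<bar> \<le> \<phi>0" "\<phi>0 \<le> \<bar>\<phi>0\<bar>" "0 \<le> \<bar>\<phi>0\<bar>" using \<phi>0 by auto
    have **: "2 * \<phi> = pi / 2 - \<bar>\<phi>0\<bar>" by (simp add: \<phi>_def)
    show "0 < \<phi>" "\<phi> < pi / 2" "\<phi> < pi / 2 - \<phi>0" "pi / 2 - \<phi>0 < pi - \<phi>"
      using * ** pi_gt_zero by linarith+
  qed
  have "filterlim (\<lambda>\<tau>. z0 + \<i> * complex_of_real \<tau>) (at z0 within (nontangential_sector z0 \<phi>0 \<phi> \<inter> upper_domain a)) (at_right 0)"
    unfolding filterlim_at
  proof
    have "((\<lambda>\<tau>. z0 + \<i> * complex_of_real \<tau>) \<longlongrightarrow> z0 + \<i> * complex_of_real 0) (at_right 0)"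
      by (intro tendsto_intros)
    then show "((\<lambda>\<tau>. z0 + \<i> * complex_of_real \<tau>) \<longlongrightarrow> z0) (at_right 0)" by simp
    have "z0 + \<i> * complex_of_real \<tau> \<in> nontangential_sector z0 \<phi>0 \<phi> \<inter> upper_domain a
        \<and> z0 + \<i> * complex_of_real \<tau> \<noteq> z0" if "\<tau> > 0" for \<tau>
    proof -
      have "z0 + \<i> * complex_of_real \<tau> = z0 + complex_of_real \<tau> * cis (pi / 2)" by simp
      then have "z0 + \<i> * complex_of_real \<tau> \<in> nontangential_sector z0 \<phi>0 \<phi>"
        unfolding nontangential_sector_def using that \<phi> by force
      moreover have "z0 + \<i> * complex_of_real \<tau> \<in> upper_domain a"
        using that z0 by (simp add: upper_domain_def graph_param_def)
      ultimately show ?thesis using that by simp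
    qed
    then show "\<forall>\<^sub>F \<tau> in at_right 0. z0 + \<i> * complex_of_real \<tau> \<in> nontangential_sector z0 \<phi>0 \<phi> \<inter> upper_domain a
        \<and> z0 + \<i> * complex_of_real \<tau> \<noteq> z0"
      by (auto simp: eventually_at_filter intro: always_eventually)
  qed
  with lim[OF \<phi>(1,2)] have "((\<lambda>\<tau>. F (z0 + \<i> * complex_of_real \<tau>)) \<longlongrightarrow> l) (at_right 0)"
    by (rule filterlim_compose)
  then show ?thesis unfolding upright_limit_def by (intro tendsto_Lim) auto
qed

section \<open>Continuity of a primitive up to the boundary\<close>

text \<open>Splitting at a threshold \<open>\<mu>\<close> gives a linearised form of Hoelder's inequality: after integration over an
interval of length \<open>h\<close> the first term contributes \<open>\<mu> h\<close>, and the second is small for large \<open>\<mu>\<close>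
because \<open>p > 1\<close>.\<close>

lemma le_threshold_add_powr:
  fixes p x \<mu> :: real
  assumes p: "1 < p" and "0 \<le> x" "0 < \<mu>"
  shows "x \<le> \<mu> + \<mu> powr (1 - p) * x powr p"
proof (cases "x \<le> \<mu>")
  case True
  then show ?thesis by (simp add: add_increasing2)
next
  case False
  then have "x > 0" using assms by simp
  then have "x = x powr (1 - p) * x powr p" by (simp add: powr_add[symmetric])
  also have "\<dots> \<le> \<mu> powr (1 - p) * x powr p"
    using False assms p by (intro mult_right_mono powr_mono2') auto
  finally show ?thesis using assms by simp
qed

text \<open>The Hardy norm enters through the bound \<open>K\<close> on integrals with respect to the parameter \<open>u\<close> instead of
arc length, so that the estimates below are estimates for functions on the real line.\<close>

locale hardy_primitive =
  fixes a :: "real \<Rightarrow> real" and M p K :: real and F \<Phi> :: "complex \<Rightarrow> complex"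
  assumes lip: "\<And>u v. \<bar>a u - a v\<bar> \<le> M * \<bar>u - v\<bar>"
    and p: "1 < p"
    and hol: "F holomorphic_on upper_domain a"
    and prim: "\<And>z. z \<in> upper_domain a \<Longrightarrow> (\<Phi> has_field_derivative F z) (at z)"
    and K: "0 \<le> K"
    and line_bound: "\<And>\<tau>. \<tau> > 0 \<Longrightarrow>
      (\<integral>\<^sup>+ u. ennreal (norm (F (graph_param a u + \<i> * complex_of_real \<tau>)) powr p) \<partial>lborel) \<le> ennreal K"
begin

definition lift :: "real \<Rightarrow> real \<Rightarrow> complex" where
  "lift u t = graph_param a u + \<i> * complex_of_real t"

definition energy :: "real \<Rightarrow> real \<Rightarrow> real" where
  "energy \<tau> u = integral {..u} (\<lambda>v. norm (F (lift v \<tau>)) powr p)"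

lemma M_nonneg: "0 \<le> M"
  using lip[of 1 0] by auto

lemma cont_a: "continuous_on S a"
  by (rule lipschitz_imp_continuous[OF lip])

lemma Re_lift [simp]: "Re (lift u t) = u" and Im_lift [simp]: "Im (lift u t) = a u + t"
  by (simp_all add: lift_def graph_param_def)

lemma lift_in_upper_domain: "0 < t \<Longrightarrow> lift u t \<in> upper_domain a"
  by (simp add: upper_domain_def)

lemma lift_eta: "lift (Re z) (Im z - a (Re z)) = z"
  by (simp add: complex_eq_iff)

lemma cont_F: "continuous_on (upper_domain a) F"
  using hol by (rule holomorphic_on_imp_continuous_on)

lemma continuous_on_lift: "continuous_on S (\<lambda>x. lift (fst x) (snd x))"
proof -
  have "continuous_on S (\<lambda>x::real\<times>real. a (fst x))"
    by (rule continuous_on_compose2[OF cont_a[of UNIV]]) (auto intro!: continuous_intros)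
  then show ?thesis unfolding lift_def graph_param_def Complex_eq by (intro continuous_intros)
qed

lemma continuous_on_F_lift: "continuous_on (UNIV \<times> {0<..}) (\<lambda>x. F (lift (fst x) (snd x)))"
  by (rule continuous_on_compose2[OF cont_F continuous_on_lift]) (auto intro: lift_in_upper_domain)

lemma continuous_on_F_horizontal: "0 < \<tau> \<Longrightarrow> continuous_on S (\<lambda>u. F (lift u \<tau>))"
  by (rule continuous_on_compose2[OF continuous_on_F_lift, of S "\<lambda>u. (u, \<tau>)", simplified]) (auto intro!: continuous_intros)

lemma continuous_on_F_vertical: "S \<subseteq> {0<..} \<Longrightarrow> continuous_on S (\<lambda>t. F (lift u t))"
  by (rule continuous_on_compose2[OF continuous_on_F_lift, of S "\<lambda>t. (u, t)", simplified]) (auto intro!: continuous_intros)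

lemma norm_lift_diff: "norm (lift u t - lift v t) \<le> (1 + M) * \<bar>u - v\<bar>"
proof -
  have "norm (lift u t - lift v t) \<le> \<bar>u - v\<bar> + \<bar>a u - a v\<bar>"
    using cmod_le[of "lift u t - lift v t"] by simp
  then show ?thesis using lip[of u v] by (simp add: algebra_simps)
qed

text \<open>The curve is only Lipschitz, so the increment is not treated as a contour integral. The inequality
is additive in the interval and, up to \<open>\<epsilon> (y - x)\<close>, true on small intervals around each point by the
mean value inequality; bisection then gives it on all intervals.\<close>

lemma increment_le_integral:
  assumes \<tau>: "0 < \<tau>" and xy: "x \<le> y"
  shows "norm (\<Phi> (lift y \<tau>) - \<Phi> (lift x \<tau>)) \<le> (1 + M) * integral {x..y} (\<lambda>u. norm (F (lift u \<tau>)))"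
proof -
  define k where "k u = norm (F (lift u \<tau>))" for u
  have k_cont: "continuous_on S k" for S
    unfolding k_def by (intro continuous_intros continuous_on_F_horizontal \<tau>)
  have k_int: "k integrable_on {s..t}" for s t by (intro integrable_continuous_interval k_cont)
  have main: "norm (\<Phi> (lift y \<tau>) - \<Phi> (lift x \<tau>)) \<le> (1 + M) * integral {x..y} k + \<epsilon> * (y - x)"
    if "\<epsilon> > 0" for \<epsilon>
    using xy
  proof (induction rule: Bolzano)
    case (trans s t r)
    have "norm (\<Phi> (lift r \<tau>) - \<Phi> (lift s \<tau>)) \<le> norm (\<Phi> (lift r \<tau>) - \<Phi> (lift t \<tau>)) + norm (\<Phi> (lift t \<tau>) - \<Phi> (lift s \<tau>))"
      by (rule norm_diff_triangle_le[of _ "\<Phi> (lift t \<tau>)"]) auto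
    also have "\<dots> \<le> ((1 + M) * integral {t..r} k + \<epsilon> * (r - t)) + ((1 + M) * integral {s..t} k + \<epsilon> * (t - s))"
      using trans by (intro add_mono) auto
    also have "\<dots> = (1 + M) * (integral {s..t} k + integral {t..r} k) + \<epsilon> * (r - s)"
      by (simp add: algebra_simps)
    also have "integral {s..t} k + integral {t..r} k = integral {s..r} k"
      using trans k_int by (intro Henstock_Kurzweil_Integration.integral_combine) auto
    finally show ?case .
  next
    case (local x0)
    define e where "e = \<epsilon> / (2 * (1 + M))"
    have e: "e > 0" "2 * (1 + M) * e = \<epsilon>" using \<open>\<epsilon> > 0\<close> M_nonneg by (auto simp: e_def)
    define w where "w = lift x0 \<tau>"
    have w: "w \<in> upper_domain a" unfolding w_def using \<tau> by (rule lift_in_upper_domain)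
    have opn: "open (upper_domain a)" by (rule open_upper_domain[OF cont_a])
    have "isCont F w" using cont_F w opn continuous_on_eq_continuous_at by blast
    then obtain r1 where r1: "r1 > 0" "\<And>z. dist z w < r1 \<Longrightarrow> dist (F z) (F w) < e"
      using e unfolding continuous_at_eps_delta by blast
    obtain r2 where r2: "r2 > 0" "ball w r2 \<subseteq> upper_domain a" using opn w openE by blast
    define r where "r = min r1 r2"
    have r: "r > 0" using r1 r2 by (simp add: r_def)
    have sub: "ball w r \<subseteq> upper_domain a"
      using r2(2) unfolding r_def by (meson min.cobounded2 order_trans subset_ball)
    have Fb: "norm (F z) \<le> k x0 + e" if "z \<in> ball w r" for z
    proof -
      have "dist (F z) (F w) < e" using that by (intro r1) (auto simp: r_def dist_commute)
      then show ?thesis using norm_triangle_ineq2[of "F z" "F w"] by (simp add: k_def w_def dist_norm)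
    qed
    have "isCont k x0" using k_cont[of UNIV] by (simp add: continuous_on_eq_continuous_at)
    then obtain r3 where r3: "r3 > 0" "\<And>u. dist u x0 < r3 \<Longrightarrow> dist (k u) (k x0) < e"
      using e unfolding continuous_at_eps_delta by blast
    define d where "d = min (r / (1 + M)) r3"
    show ?case
    proof (intro exI[of _ d] conjI allI impI)
      show "d > 0" using r r3 M_nonneg by (simp add: d_def)
      fix s t assume st: "s \<le> x0 \<and> x0 \<le> t \<and> t - s < d"
      have inb: "lift u \<tau> \<in> ball w r" if "s \<le> u" "u \<le> t" for u
      proof -
        have "norm (lift u \<tau> - w) \<le> (1 + M) * \<bar>u - x0\<bar>" unfolding w_def by (rule norm_lift_diff)
        also have "\<dots> < (1 + M) * (r / (1 + M))"
          using st that M_nonneg by (intro mult_strict_left_mono) (auto simp: d_def)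
        also have "\<dots> = r" using M_nonneg by simp
        finally show ?thesis by (simp add: dist_norm norm_minus_commute)
      qed
      have k0: "0 \<le> k x0 + e" using e by (simp add: k_def add_nonneg_nonneg)
      have "norm (\<Phi> (lift t \<tau>) - \<Phi> (lift s \<tau>)) \<le> (k x0 + e) * norm (lift t \<tau> - lift s \<tau>)"
      proof (rule field_differentiable_bound[of "ball w r" \<Phi> F])
        show "(\<Phi> has_field_derivative F z) (at z within ball w r)" if "z \<in> ball w r" for z
          using that sub by (intro has_field_derivative_at_within[OF prim]) blast
        show "norm (F z) \<le> k x0 + e" if "z \<in> ball w r" for z by (rule Fb[OF that])
        show "lift s \<tau> \<in> ball w r" by (rule inb) (use st in linarith)+
        show "lift t \<tau> \<in> ball w r" by (rule inb) (use st in linarith)+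
      qed (rule convex_ball)
      also have "\<dots> \<le> (k x0 + e) * ((1 + M) * \<bar>t - s\<bar>)"
        by (intro mult_left_mono norm_lift_diff k0)
      also have "\<dots> = (1 + M) * ((k x0 - e) * (t - s)) + \<epsilon> * (t - s)"
        using st unfolding e(2)[symmetric] by (simp add: algebra_simps)
      also have "(k x0 - e) * (t - s) \<le> integral {s..t} k"
      proof -
        have "integral {s..t} (\<lambda>_. k x0 - e) \<le> integral {s..t} k"
        proof (rule integral_le)
          fix u assume "u \<in> {s..t}"
          moreover have "t - s < r3" using st by (simp add: d_def)
          ultimately have "dist u x0 < r3" using st by (auto simp: dist_real_def)
          then have "dist (k u) (k x0) < e" by (rule r3)
          then show "k x0 - e \<le> k u" by (simp add: dist_real_def)
        qed (use k_int in auto)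
        then show ?thesis using st by (simp add: mult.commute)
      qed
      finally show "norm (\<Phi> (lift t \<tau>) - \<Phi> (lift s \<tau>)) \<le> (1 + M) * integral {s..t} k + \<epsilon> * (t - s)"
        using M_nonneg by simp
    qed
  qed
  have "norm (\<Phi> (lift y \<tau>) - \<Phi> (lift x \<tau>)) \<le> (1 + M) * integral {x..y} k + e" if "e > 0" for e
  proof -
    have "norm (\<Phi> (lift y \<tau>) - \<Phi> (lift x \<tau>)) \<le> (1 + M) * integral {x..y} k + e / (y - x + 1) * (y - x)"
      using that xy by (intro main) auto
    also have "e / (y - x + 1) * (y - x) \<le> e" using that xy by (simp add: field_simps)
    finally show ?thesis by simp
  qed
  then show ?thesis unfolding k_def by (rule field_le_epsilon)
qed

lemma energy_integrable:
  assumes \<tau>: "0 < \<tau>"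
  shows "integrable lborel (\<lambda>u. norm (F (lift u \<tau>)) powr p)"
proof (rule integrableI_bounded)
  have "(\<lambda>u. F (lift u \<tau>)) \<in> borel_measurable borel"
    by (intro borel_measurable_continuous_onI continuous_on_F_horizontal \<tau>)
  then show "(\<lambda>u. norm (F (lift u \<tau>)) powr p) \<in> borel_measurable lborel" by simp
  have "(\<integral>\<^sup>+ u. ennreal (norm (norm (F (lift u \<tau>)) powr p)) \<partial>lborel) \<le> ennreal K"
    using line_bound[OF \<tau>] by (simp add: lift_def)
  also have "\<dots> < \<infinity>" by simp
  finally show "(\<integral>\<^sup>+ u. ennreal (norm (norm (F (lift u \<tau>)) powr p)) \<partial>lborel) < \<infinity>" .
qed

lemma energy_integrable_on:
  assumes \<tau>: "0 < \<tau>" and S: "S \<in> sets borel"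
  shows "(\<lambda>u. norm (F (lift u \<tau>)) powr p) integrable_on S"
proof -
  have "set_integrable lborel S (\<lambda>u. norm (F (lift u \<tau>)) powr p)"
    unfolding set_integrable_def using S by (intro integrable_mult_indicator energy_integrable[OF \<tau>]) simp
  then show ?thesis by (rule set_borel_integral_eq_integral(1))
qed

lemma energy_diff:
  assumes \<tau>: "0 < \<tau>" and "x \<le> y"
  shows "energy \<tau> y - energy \<tau> x = integral {x..y} (\<lambda>v. norm (F (lift v \<tau>)) powr p)"
proof -
  have "{..y} = {..x} \<union> {x..y}" "{..x} \<inter> {x..y} = {x}" using \<open>x \<le> y\<close> by auto
  then show ?thesis
    unfolding energy_def using energy_integrable_on[OF \<tau>] by simp
qed

lemma energy_bounds:
  assumes \<tau>: "0 < \<tau>"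
  shows "0 \<le> energy \<tau> u" "energy \<tau> u \<le> K"
proof -
  let ?f = "\<lambda>v. norm (F (lift v \<tau>)) powr p"
  show "0 \<le> energy \<tau> u" unfolding energy_def
    using energy_integrable_on[OF \<tau>] by (intro integral_nonneg) auto
  have "energy \<tau> u \<le> integral UNIV ?f"
    unfolding energy_def using energy_integrable_on[OF \<tau>] by (intro integral_subset_le) auto
  also have "\<dots> = integral\<^sup>L lborel ?f"
    using integral_lborel[OF energy_integrable[OF \<tau>]] by simp
  also have "\<dots> = enn2real (\<integral>\<^sup>+ v. ennreal (?f v) \<partial>lborel)"
    using energy_integrable[OF \<tau>] by (intro integral_eq_nn_integral) auto
  also have "\<dots> \<le> K"
    using line_bound[OF \<tau>] K by (intro enn2real_leI) (auto simp: lift_def)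
  finally show "energy \<tau> u \<le> K" .
qed

lemma increment_le_energy:
  assumes \<tau>: "0 < \<tau>" and \<mu>: "0 < \<mu>" and xy: "x \<le> y"
  shows "norm (\<Phi> (lift y \<tau>) - \<Phi> (lift x \<tau>))
    \<le> (1 + M) * (\<mu> * (y - x) + \<mu> powr (1 - p) * (energy \<tau> y - energy \<tau> x))"
proof -
  let ?f = "\<lambda>v. norm (F (lift v \<tau>)) powr p"
  have int: "?f integrable_on {x..y}" by (rule energy_integrable_on[OF \<tau>]) simp
  have "integral {x..y} (\<lambda>u. norm (F (lift u \<tau>))) \<le> integral {x..y} (\<lambda>u. \<mu> + \<mu> powr (1 - p) * ?f u)"
  proof (rule integral_le)
    show "(\<lambda>u. norm (F (lift u \<tau>))) integrable_on {x..y}"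
      by (intro integrable_continuous_interval continuous_intros continuous_on_F_horizontal \<tau>)
    show "(\<lambda>u. \<mu> + \<mu> powr (1 - p) * ?f u) integrable_on {x..y}"
      by (intro integrable_add integrable_on_mult_right int integrable_const_ivl)
  qed (use le_threshold_add_powr[OF p] \<mu> in auto)
  also have "\<dots> = \<mu> * (y - x) + \<mu> powr (1 - p) * integral {x..y} ?f"
    using xy int by (subst Henstock_Kurzweil_Integration.integral_add) (auto intro!: integrable_on_mult_right)
  also have "integral {x..y} ?f = energy \<tau> y - energy \<tau> x" using energy_diff[OF \<tau> xy] by simp
  finally have "(1 + M) * integral {x..y} (\<lambda>u. norm (F (lift u \<tau>)))
     \<le> (1 + M) * (\<mu> * (y - x) + \<mu> powr (1 - p) * (energy \<tau> y - energy \<tau> x))"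
    using M_nonneg by (intro mult_left_mono) auto
  then show ?thesis using increment_le_integral[OF \<tau> xy] by linarith
qed

text \<open>Choose the threshold \<open>\<mu>\<close> so large that the energy term is below \<open>\<epsilon> / 2\<close> on every interval, and only
then the length of the interval.\<close>

lemma equicontinuous:
  assumes "0 < \<epsilon>"
  obtains \<delta> where "\<delta> > 0"
    "\<And>x y \<tau>. 0 < \<tau> \<Longrightarrow> \<bar>x - y\<bar> < \<delta> \<Longrightarrow> norm (\<Phi> (lift x \<tau>) - \<Phi> (lift y \<tau>)) < \<epsilon>"
proof -
  \<comment> \<open>\<open>\<eta>\<close> is the value of \<open>\<mu> powr (1 - p)\<close> at which the energy term falls below \<open>\<epsilon> / 2\<close>.\<close>
  define \<eta> where "\<eta> = \<epsilon> / 2 / (1 + M) / (K + 1)"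
  have \<eta>: "\<eta> > 0" "(1 + M) * (\<eta> * (K + 1)) = \<epsilon> / 2"
  proof -
    have pos: "1 + M > 0" "K + 1 > 0" using M_nonneg K by auto
    then show "\<eta> > 0" using assms by (simp add: \<eta>_def)
    have "\<eta> * (K + 1) = \<epsilon> / 2 / (1 + M)" using pos by (simp add: \<eta>_def)
    then show "(1 + M) * (\<eta> * (K + 1)) = \<epsilon> / 2"
      using nonzero_mult_div_cancel_left[of "1 + M" "\<epsilon> / 2"] pos by (metis less_irrefl times_divide_eq_right)
  qed
  define \<mu> where "\<mu> = \<eta> powr (1 / (1 - p))"
  have \<mu>: "\<mu> > 0" "\<mu> powr (1 - p) = \<eta>" using \<eta> p by (auto simp: \<mu>_def powr_powr)
  define \<delta> where "\<delta> = \<epsilon> / 2 / (1 + M) / \<mu>"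
  have \<delta>: "\<delta> > 0" "(1 + M) * (\<mu> * \<delta>) = \<epsilon> / 2" 
  proof -
    have pos: "1 + M > 0" using M_nonneg by auto
    then show "\<delta> > 0" using assms \<mu> by (simp add: \<delta>_def)
    have "\<mu> * \<delta> = \<epsilon> / 2 / (1 + M)" using \<mu> by (simp add: \<delta>_def)
    then show "(1 + M) * (\<mu> * \<delta>) = \<epsilon> / 2"
      using nonzero_mult_div_cancel_left[of "1 + M" "\<epsilon> / 2"] pos by (metis less_irrefl times_divide_eq_right)
  qed
  have main: "norm (\<Phi> (lift y \<tau>) - \<Phi> (lift x \<tau>)) < \<epsilon>" if "0 < \<tau>" "x \<le> y" "y - x < \<delta>" for x y \<tau>
  proof -
    have "energy \<tau> y - energy \<tau> x \<le> K" using energy_bounds[OF \<open>0 < \<tau>\<close>, of x] energy_bounds[OF \<open>0 < \<tau>\<close>, of y] by linarith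
    then have "\<eta> * (energy \<tau> y - energy \<tau> x) < \<eta> * (K + 1)" using \<eta> by (intro mult_strict_left_mono) auto
    moreover have "\<mu> * (y - x) \<le> \<mu> * \<delta>" using that \<mu> by (intro mult_left_mono) auto
    ultimately have "(1 + M) * (\<mu> * (y - x) + \<mu> powr (1 - p) * (energy \<tau> y - energy \<tau> x)) < (1 + M) * (\<mu> * \<delta> + \<eta> * (K + 1))"
      unfolding \<mu>(2) using M_nonneg by (intro mult_strict_left_mono) auto
    also have "\<dots> = \<epsilon>" using \<eta>(2) \<delta>(2) by (simp add: distrib_left)
    finally show ?thesis using increment_le_energy[OF that(1) \<mu>(1) that(2)] by linarith
  qed
  show thesis
  proof (rule that[OF \<delta>(1)])
    fix x y \<tau> :: real assume "0 < \<tau>" "\<bar>x - y\<bar> < \<delta>"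
    then show "norm (\<Phi> (lift x \<tau>) - \<Phi> (lift y \<tau>)) < \<epsilon>"
      using main[of \<tau> x y] main[of \<tau> y x] by (cases "x \<le> y") (auto simp: norm_minus_commute)
  qed
qed

lemma F_lift_measurable:
  "(\<lambda>x. ennreal (norm (F (lift (fst x) (snd x)))) * indicator {0<..1} (snd x)) \<in> borel_measurable (lborel \<Otimes>\<^sub>M lborel)"
proof -
  have "(\<lambda>x::real\<times>real. indicator (UNIV \<times> {0<..}) x *\<^sub>R F (lift (fst x) (snd x))) \<in> borel_measurable borel"
    by (intro borel_measurable_continuous_on_indicator continuous_on_F_lift borel_open open_Times) auto
  then have [measurable]: "(\<lambda>x::real\<times>real. indicator (UNIV \<times> {0<..}) x *\<^sub>R F (lift (fst x) (snd x))) \<in> borel_measurable (lborel \<Otimes>\<^sub>M lborel)"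
    by (simp add: lborel_prod)
  have "(\<lambda>x::real\<times>real. ennreal (norm (indicator (UNIV \<times> {0<..}) x *\<^sub>R F (lift (fst x) (snd x)))) * indicator {0<..1} (snd x))
      \<in> borel_measurable (lborel \<Otimes>\<^sub>M lborel)"
    by measurable
  also have "(\<lambda>x::real\<times>real. ennreal (norm (indicator (UNIV \<times> {0<..}) x *\<^sub>R F (lift (fst x) (snd x)))) * indicator {0<..1} (snd x))
     = (\<lambda>x. ennreal (norm (F (lift (fst x) (snd x)))) * indicator {0<..1} (snd x))"
    by (intro ext) (auto simp: indicator_def)
  finally show ?thesis .
qed

text \<open>By Fubini, the vertical integrals have a finite integral over \<open>u \<in> [x, y]\<close>, since \<open>|F| \<le> 1 + |F|\<^sup>p\<close> and
the horizontal integrals of \<open>|F|\<^sup>p\<close> are at most \<open>K\<close>.\<close>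

lemma ex_finite_vertical_integral:
  assumes xy: "x < y"
  obtains u where "x \<le> u" "u \<le> y"
    "(\<integral>\<^sup>+ t. ennreal (norm (F (lift u t))) * indicator {0<..1} t \<partial>lborel) < \<infinity>"
proof -
  define h where "h u t = ennreal (norm (F (lift u t))) * indicator {0<..1} t" for u t
  have h_meas: "(\<lambda>(u, t). h u t * indicator {x..y} u) \<in> borel_measurable (lborel \<Otimes>\<^sub>M lborel)"
    using F_lift_measurable unfolding h_def split_beta by measurable
  have "(\<integral>\<^sup>+ u. (\<integral>\<^sup>+ t. h u t \<partial>lborel) * indicator {x..y} u \<partial>lborel)
      = (\<integral>\<^sup>+ u. (\<integral>\<^sup>+ t. h u t * indicator {x..y} u \<partial>lborel) \<partial>lborel)"
    by (intro nn_integral_cong) (auto simp: indicator_def)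
  also have "\<dots> = (\<integral>\<^sup>+ t. (\<integral>\<^sup>+ u. h u t * indicator {x..y} u \<partial>lborel) \<partial>lborel)"
    by (rule lborel_pair.Fubini'[OF h_meas, symmetric])
  also have "\<dots> \<le> (\<integral>\<^sup>+ t. ennreal ((y - x) + K) * indicator {0<..1::real} t \<partial>lborel)"
  proof (rule nn_integral_mono)
    fix t :: real
    show "(\<integral>\<^sup>+ u. h u t * indicator {x..y} u \<partial>lborel) \<le> ennreal ((y - x) + K) * indicator {0<..1} t"
    proof (cases "t \<in> {0<..1}")
      case True
      then have t: "0 < t" by simp
      have "(\<integral>\<^sup>+ u. h u t * indicator {x..y} u \<partial>lborel)
          \<le> (\<integral>\<^sup>+ u. indicator {x..y} u + ennreal (norm (F (lift u t)) powr p) \<partial>lborel)"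
      proof (rule nn_integral_mono)
        fix u
        have "norm (F (lift u t)) \<le> 1 + norm (F (lift u t)) powr p"
          using le_threshold_add_powr[OF p, of "norm (F (lift u t))" 1] by simp
        then have "ennreal (norm (F (lift u t))) \<le> 1 + ennreal (norm (F (lift u t)) powr p)"
          by (metis ennreal_1 ennreal_leI ennreal_plus powr_ge_zero zero_le_one)
        then show "h u t * indicator {x..y} u \<le> indicator {x..y} u + ennreal (norm (F (lift u t)) powr p)"
          using True by (auto simp: h_def indicator_def)
      qed
      also have "\<dots> = (\<integral>\<^sup>+ u. indicator {x..y} u \<partial>lborel) + (\<integral>\<^sup>+ u. ennreal (norm (F (lift u t)) powr p) \<partial>lborel)"
        using energy_integrable[OF t] by (intro nn_integral_add) auto
      also have "\<dots> \<le> ennreal (y - x) + ennreal K"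
        using line_bound[OF t] xy by (intro add_mono) (auto simp: lift_def)
      finally show ?thesis using True xy K by simp
    qed (simp add: h_def)
  qed
  also have "\<dots> = ennreal ((y - x) + K)"
    by (subst nn_integral_cmult) (auto simp: emeasure_lborel_Ioc)
  also have "\<dots> < \<infinity>" by simp
  finally have fin: "(\<integral>\<^sup>+ u. (\<integral>\<^sup>+ t. h u t \<partial>lborel) * indicator {x..y} u \<partial>lborel) < \<infinity>" .
  have "\<exists>u\<in>{x..y}. (\<integral>\<^sup>+ t. h u t \<partial>lborel) < \<infinity>"
  proof (rule ccontr)
    assume "\<not> ?thesis"
    then have "\<And>u. u \<in> {x..y} \<Longrightarrow> (\<integral>\<^sup>+ t. h u t \<partial>lborel) = \<infinity>" by (metis infinity_ennreal_def less_top)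
    then have "(\<integral>\<^sup>+ u. (\<integral>\<^sup>+ t. h u t \<partial>lborel) * indicator {x..y} u \<partial>lborel) = (\<integral>\<^sup>+ u. \<infinity> * indicator {x..y} u \<partial>lborel)"
      by (intro nn_integral_cong) (auto simp: indicator_def)
    also have "\<dots> = \<infinity> * ennreal (y - x)"
      using xy by (subst nn_integral_cmult) auto
    also have "\<dots> = \<infinity>" using xy by (simp add: ennreal_top_mult)
    finally show False using fin by simp
  qed
  then show thesis using that unfolding h_def by auto
qed

lemma vertical_limit_if_finite_integral:
  assumes fin: "(\<integral>\<^sup>+ t. ennreal (norm (F (lift u t))) * indicator {0<..1} t \<partial>lborel) < \<infinity>"
  shows "\<exists>l. ((\<lambda>t. \<Phi> (lift u t)) \<longlongrightarrow> l) (at_right 0)"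
proof -
  let ?g = "\<lambda>t. \<i> * F (lift u t)"
  have int: "set_integrable lborel {0<..1} ?g"
    unfolding set_integrable_def
  proof (rule integrableI_bounded)
    have "(\<lambda>t. indicator {0<..1} t *\<^sub>R ?g t) \<in> borel_measurable borel"
      by (intro borel_measurable_continuous_on_indicator continuous_intros continuous_on_F_vertical) auto
    then show "(\<lambda>t. indicator {0<..1} t *\<^sub>R ?g t) \<in> borel_measurable lborel" by simp
    have "(\<integral>\<^sup>+ t. ennreal (norm (indicator {0<..1} t *\<^sub>R ?g t)) \<partial>lborel) = (\<integral>\<^sup>+ t. ennreal (norm (F (lift u t))) * indicator {0<..1} t \<partial>lborel)"
      by (intro nn_integral_cong) (auto simp: indicator_def norm_mult)
    then show "(\<integral>\<^sup>+ t. ennreal (norm (indicator {0<..1} t *\<^sub>R ?g t)) \<partial>lborel) < \<infinity>" using fin by simp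
  qed
  have eq: "\<Phi> (lift u 1) - (LINT s:{t..1}|lborel. ?g s) = \<Phi> (lift u t)" if t: "0 < t" "t < 1" for t
  proof -
    have "((\<lambda>t. \<Phi> (lift u t)) has_vector_derivative ?g s) (at s within {t..1})" if "s \<in> {t..1}" for s
    proof -
      have "((\<lambda>t. lift u t) has_vector_derivative \<i>) (at s within {t..1})"
        unfolding lift_def by (auto intro!: derivative_eq_intros)
      moreover have "(\<Phi> has_field_derivative F (lift u s)) (at (lift u s) within lift u ` {t..1})"
        using t that by (intro has_field_derivative_at_within[OF prim] lift_in_upper_domain) auto
      ultimately show ?thesis
        using field_vector_diff_chain_within[of "lift u" \<i> s "{t..1}" \<Phi> "F (lift u s)"] by (simp add: o_def)
    qed
    then have "(?g has_integral (\<Phi> (lift u 1) - \<Phi> (lift u t))) {t..1}"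
      using t by (intro fundamental_theorem_of_calculus) auto
    moreover have "set_integrable lborel {t..1} ?g"
      using t by (intro set_integrable_subset[OF int]) auto
    ultimately have "(LINT s:{t..1}|lborel. ?g s) = \<Phi> (lift u 1) - \<Phi> (lift u t)"
      using set_borel_integral_eq_integral(2) integral_unique by metis
    then show ?thesis by simp
  qed
  have "((\<lambda>t. \<Phi> (lift u 1) - (LINT s:{t..1}|lborel. ?g s)) \<longlongrightarrow> \<Phi> (lift u 1) - (LINT s:{0<..1}|lborel. ?g s)) (at_right 0)"
    by (intro tendsto_diff tendsto_const tendsto_set_lebesgue_integral_at_right int) auto
  moreover have "\<forall>\<^sub>F t in at_right 0. \<Phi> (lift u 1) - (LINT s:{t..1}|lborel. ?g s) = \<Phi> (lift u t)"
  proof (rule eventually_mono)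
    show "\<forall>\<^sub>F t in at_right 0. t \<in> {0<..<1::real}" by (rule eventually_at_right_real) simp
    fix t :: real assume "t \<in> {0<..<1}"
    then show "\<Phi> (lift u 1) - (LINT s:{t..1}|lborel. ?g s) = \<Phi> (lift u t)" by (intro eq) simp_all
  qed
  ultimately have "((\<lambda>t. \<Phi> (lift u t)) \<longlongrightarrow> \<Phi> (lift u 1) - (LINT s:{0<..1}|lborel. ?g s)) (at_right 0)"
    by (rule Lim_transform_eventually)
  then show ?thesis by blast
qed

text \<open>The convergence for a dense set of \<open>u\<close> spreads to all \<open>u\<close> by equicontinuity.\<close>

lemma vertical_limit_exists: "\<exists>l. ((\<lambda>t. \<Phi> (lift u t)) \<longlongrightarrow> l) (at_right 0)"
proof -
  have "cauchy_filter (filtermap (\<lambda>t. \<Phi> (lift u t)) (at_right 0))"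
    unfolding cauchy_filter_metric_filtermap
  proof (intro allI impI)
    fix e :: real assume e: "e > 0"
    then obtain \<delta> where d: "\<delta> > 0"
      "\<And>x y \<tau>. 0 < \<tau> \<Longrightarrow> \<bar>x - y\<bar> < \<delta> \<Longrightarrow> norm (\<Phi> (lift x \<tau>) - \<Phi> (lift y \<tau>)) < e / 4"
      using equicontinuous[of "e / 4"] by (metis divide_pos_pos zero_less_numeral)
    obtain v where v: "u \<le> v" "v \<le> u + \<delta> / 2" "(\<integral>\<^sup>+ t. ennreal (norm (F (lift v t))) * indicator {0<..1} t \<partial>lborel) < \<infinity>"
      using ex_finite_vertical_integral[of u "u + \<delta> / 2"] d(1) by auto
    obtain l where l: "((\<lambda>t. \<Phi> (lift v t)) \<longlongrightarrow> l) (at_right 0)"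
      using vertical_limit_if_finite_integral[OF v(3)] by blast
    have uv: "\<bar>u - v\<bar> < \<delta>" using v d by auto
    let ?P = "\<lambda>t. 0 < t \<and> dist (\<Phi> (lift v t)) l < e / 4"
    have near: "dist (\<Phi> (lift u t)) l < e / 2" if "?P t" for t
      using d(2)[OF _ uv, of t] that dist_triangle[of "\<Phi> (lift u t)" l "\<Phi> (lift v t)"]
      by (simp add: dist_norm)
    have "dist (\<Phi> (lift u t)) (\<Phi> (lift u s)) < e" if "?P t" "?P s" for t s
      using near[OF that(1)] near[OF that(2)] by (rule dist_triangle_half_l)
    moreover have "eventually ?P (at_right 0)"
      using eventually_at_right_less[of 0] tendstoD[OF l, of "e / 4"] e by (auto intro: eventually_conj)
    ultimately show "\<exists>P. eventually P (at_right 0) \<and> (\<forall>x y. P x \<and> P y \<longrightarrow> dist (\<Phi> (lift u x)) (\<Phi> (lift u y)) < e)"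
      by (intro exI[of _ ?P]) blast
  qed
  moreover have "complete (UNIV :: complex set)" by (rule complete_UNIV)
  ultimately show ?thesis
    using complete_uniform[where S="UNIV :: complex set"] by (force simp add: filterlim_def)
qed

definition boundary_value :: "real \<Rightarrow> complex" where
  "boundary_value u = Lim (at_right 0) (\<lambda>t. \<Phi> (lift u t))"

lemma tendsto_boundary_value: "((\<lambda>t. \<Phi> (lift u t)) \<longlongrightarrow> boundary_value u) (at_right 0)"
proof -
  obtain l where l: "((\<lambda>t. \<Phi> (lift u t)) \<longlongrightarrow> l) (at_right 0)" using vertical_limit_exists by blast
  then have "boundary_value u = l" unfolding boundary_value_def by (intro tendsto_Lim) auto
  with l show ?thesis by simp
qed

definition extension :: "complex \<Rightarrow> complex" where
  "extension z = (if z \<in> upper_domain a then \<Phi> z else boundary_value (Re z))"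

lemma extension_lift: "0 < t \<Longrightarrow> extension (lift u t) = \<Phi> (lift u t)"
  by (simp add: extension_def lift_in_upper_domain)

lemma extension_graph: "extension (graph_param a u) = boundary_value u"
  by (simp add: extension_def upper_domain_def graph_param_def)

lemma extension_has_field_derivative:
  assumes "z \<in> upper_domain a"
  shows "(extension has_field_derivative F z) (at z)"
proof (rule has_field_derivative_transform_within_open[OF prim[OF assms]])
  show "open (upper_domain a)" by (rule open_upper_domain[OF cont_a])
qed (use assms in \<open>auto simp: extension_def\<close>)

text \<open>Near a boundary point, equicontinuity in the horizontal direction, uniform up to the boundary, is
combined with convergence along a single vertical line.\<close>

lemma continuous_on_extension: "continuous_on (closed_upper_domain a) extension"
  unfolding continuous_on_eq_continuous_within
proof
  fix z0 assume z0: "z0 \<in> closed_upper_domain a"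
  show "continuous (at z0 within closed_upper_domain a) extension"
  proof (cases "z0 \<in> upper_domain a")
    case True
    then show ?thesis
      using extension_has_field_derivative DERIV_isCont continuous_at_imp_continuous_at_within by blast
  next
    case False
    define u0 where "u0 = Re z0"
    have im0: "Im z0 = a u0" using z0 False by (auto simp: closed_upper_domain_def upper_domain_def u0_def)
    have ext0: "extension z0 = boundary_value u0" using False by (simp add: extension_def u0_def)
    show ?thesis
      unfolding continuous_within_eps_delta ext0
    proof (intro allI impI)
      fix e :: real assume e: "e > 0"
      then obtain d1 where d1: "d1 > 0"
        "\<And>x y \<tau>. 0 < \<tau> \<Longrightarrow> \<bar>x - y\<bar> < d1 \<Longrightarrow> norm (\<Phi> (lift x \<tau>) - \<Phi> (lift y \<tau>)) < e / 2"
        using equicontinuous[of "e / 2"] by (metis half_gt_zero)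
      have b: "norm (boundary_value u - boundary_value u0) \<le> e / 2" if "\<bar>u - u0\<bar> < d1" for u
      proof (rule tendsto_upperbound)
        show "((\<lambda>t. norm (\<Phi> (lift u t) - \<Phi> (lift u0 t))) \<longlongrightarrow> norm (boundary_value u - boundary_value u0)) (at_right 0)"
          by (intro tendsto_intros tendsto_boundary_value)
        show "\<forall>\<^sub>F t in at_right 0. norm (\<Phi> (lift u t) - \<Phi> (lift u0 t)) \<le> e / 2"
          using eventually_at_right_less[of 0] by eventually_elim (use d1(2) that in \<open>auto intro: less_imp_le\<close>)
      qed simp
      obtain d2 where d2: "d2 > 0" "\<And>t. 0 < t \<Longrightarrow> t < d2 \<Longrightarrow> norm (\<Phi> (lift u0 t) - boundary_value u0) < e / 2"
        using tendstoD[OF tendsto_boundary_value, of "e / 2" u0] e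
        unfolding eventually_at_right_field dist_norm by auto
      define d where "d = min d1 (d2 / (1 + M))"
      show "\<exists>d>0. \<forall>z\<in>closed_upper_domain a. dist z z0 < d \<longrightarrow> dist (extension z) (boundary_value u0) < e"
      proof (intro exI[of _ d] conjI ballI impI)
        show "d > 0" using d1 d2 M_nonneg by (simp add: d_def)
        fix z assume z: "z \<in> closed_upper_domain a" and dz: "dist z z0 < d"
        define u t where "u = Re z" and "t = Im z - a u"
        have zl: "z = lift u t" unfolding u_def t_def by (simp add: lift_eta)
        have t0: "0 \<le> t" using z by (simp add: closed_upper_domain_def t_def u_def)
        have n: "norm (z - z0) < d" using dz by (simp add: dist_norm)
        have un: "\<bar>u - u0\<bar> \<le> norm (z - z0)" using abs_Re_le_cmod[of "z - z0"] by (simp add: u_def u0_def)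
        then have ud: "\<bar>u - u0\<bar> < d1" using n by (simp add: d_def)
        have "\<bar>Im z - Im z0\<bar> \<le> norm (z - z0)" using abs_Im_le_cmod[of "z - z0"] by simp
        then have "t \<le> norm (z - z0) + M * \<bar>u - u0\<bar>"
          using lip[of u u0] im0 unfolding t_def by linarith
        also have "\<dots> \<le> (1 + M) * norm (z - z0)"
          using mult_left_mono[OF un M_nonneg] by (simp add: algebra_simps)
        also have "\<dots> < (1 + M) * (d2 / (1 + M))"
          using n M_nonneg by (intro mult_strict_left_mono) (auto simp: d_def)
        also have "\<dots> = d2" using M_nonneg by simp
        finally have td: "t < d2" .
        show "dist (extension z) (boundary_value u0) < e"
        proof (cases "t = 0")
          case True
          then have "extension z = boundary_value u"
            by (simp add: extension_def upper_domain_def zl)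
          then show ?thesis using b[OF ud] e by (simp add: dist_norm)
        next
          case False
          then have t: "0 < t" using t0 by simp
          have "dist (\<Phi> (lift u t)) (\<Phi> (lift u0 t)) < e / 2" using d1(2)[OF t ud] by (simp add: dist_norm)
          moreover have "dist (boundary_value u0) (\<Phi> (lift u0 t)) < e / 2"
            using d2(2)[OF t td] by (simp add: dist_norm norm_minus_commute)
          ultimately have "dist (\<Phi> (lift u t)) (boundary_value u0) < e" by (rule dist_triangle_half_l)
          then show ?thesis using extension_lift[OF t, of u] by (simp add: zl)
        qed
      qed
    qed
  qed
qed

section \<open>Differentiability of the boundary trace\<close>

text \<open>This is the lower limit of the energies as \<open>\<tau> \<rightarrow> 0\<close>. The lower limit is superadditive, so it keeps lower
bounds on increments although the energies themselves need not converge.\<close>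

definition limit_energy :: "real \<Rightarrow> real" where
  "limit_energy u = Sup {r. \<forall>\<^sub>F \<tau> in at_right 0. r \<le> energy \<tau> u}"

lemma limit_energy_set:
  "0 \<in> {r. \<forall>\<^sub>F \<tau> in at_right 0. r \<le> energy \<tau> u}"
  "bdd_above {r. \<forall>\<^sub>F \<tau> in at_right 0. r \<le> energy \<tau> u}"
proof -
  show "0 \<in> {r. \<forall>\<^sub>F \<tau> in at_right 0. r \<le> energy \<tau> u}"
    using eventually_at_right_less[of 0] by (auto elim!: eventually_mono intro: energy_bounds)
  show "bdd_above {r. \<forall>\<^sub>F \<tau> in at_right 0. r \<le> energy \<tau> u}"
  proof (rule bdd_aboveI[of _ K])
    fix r assume "r \<in> {r. \<forall>\<^sub>F \<tau> in at_right 0. r \<le> energy \<tau> u}"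
    then have "\<forall>\<^sub>F \<tau> in at_right 0. r \<le> energy \<tau> u \<and> 0 < \<tau>"
      using eventually_at_right_less[of 0] by (auto intro: eventually_conj)
    then have "\<exists>\<tau>. r \<le> energy \<tau> u \<and> 0 < \<tau>"
      by (rule eventually_happens'[rotated]) simp
    then show "r \<le> K" using energy_bounds(2) order_trans by blast
  qed
qed

lemma boundary_increment_le_energy:
  assumes xy: "x \<le> y"
  shows "norm (boundary_value y - boundary_value x) \<le> (1 + M) * ((y - x) + (limit_energy y - limit_energy x))"
proof -
  \<comment> \<open>The limit as \<open>\<tau> \<rightarrow> 0\<close> of a lower bound for \<open>energy \<tau> y - energy \<tau> x\<close>, by \<open>increment_le_energy\<close> with
      threshold 1.\<close>
  define c where "c = norm (boundary_value y - boundary_value x) / (1 + M) - (y - x)"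
  have M1: "1 + M > 0" using M_nonneg by simp
  have lim: "((\<lambda>t. norm (\<Phi> (lift y t) - \<Phi> (lift x t)) / (1 + M) - (y - x)) \<longlongrightarrow> c) (at_right 0)"
    unfolding c_def using M1 by (intro tendsto_intros tendsto_boundary_value) auto
  have step: "r + c - e \<le> limit_energy y" if r: "\<forall>\<^sub>F \<tau> in at_right 0. r \<le> energy \<tau> x" and e: "e > 0" for r e
    unfolding limit_energy_def
  proof (rule cSup_upper[OF _ limit_energy_set(2)])
    have "\<forall>\<^sub>F t in at_right 0. c - e < norm (\<Phi> (lift y t) - \<Phi> (lift x t)) / (1 + M) - (y - x)"
      using e by (intro order_tendstoD(1)[OF lim]) auto
    then have "\<forall>\<^sub>F \<tau> in at_right 0. r + c - e \<le> energy \<tau> y"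
      using r eventually_at_right_less[of 0]
    proof eventually_elim
      fix \<tau> :: real
      assume 1: "c - e < norm (\<Phi> (lift y \<tau>) - \<Phi> (lift x \<tau>)) / (1 + M) - (y - x)"
        and 2: "r \<le> energy \<tau> x" and \<tau>: "0 < \<tau>"
      have "norm (\<Phi> (lift y \<tau>) - \<Phi> (lift x \<tau>)) / (1 + M) \<le> (y - x) + (energy \<tau> y - energy \<tau> x)"
        using increment_le_energy[OF \<tau> zero_less_one xy] M1 by (simp add: pos_divide_le_eq mult.commute)
      then show "r + c - e \<le> energy \<tau> y" using 1 2 by linarith
    qed
    then show "r + c - e \<in> {r. \<forall>\<^sub>F \<tau> in at_right 0. r \<le> energy \<tau> y}" by simp
  qed
  have "limit_energy x \<le> limit_energy y - c + e" if "e > 0" for e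
    unfolding limit_energy_def[of x]
    using step[OF _ that] limit_energy_set(1)[of x] by (intro cSup_least) force+
  then have "limit_energy x \<le> limit_energy y - c" by (rule field_le_epsilon)
  then have "norm (boundary_value y - boundary_value x) / (1 + M) \<le> (y - x) + (limit_energy y - limit_energy x)"
    by (simp add: c_def)
  then show ?thesis using M1 by (simp add: pos_divide_le_eq mult.commute)
qed

text \<open>The real and imaginary parts of the trace are dominated by one and the same increasing function.\<close>

lemma boundary_value_differentiable_ae:
  "AE u in lborel. \<exists>\<beta>. (boundary_value has_vector_derivative \<beta>) (at u)"
proof -
  define g where "g u = (1 + M) * (u + limit_energy u)" for u
  have dom: "norm (boundary_value y - boundary_value x) \<le> g y - g x" if "x \<le> y" for x y
    using boundary_increment_le_energy[OF that] by (simp add: g_def algebra_simps)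
  have "AE u in lborel. (\<lambda>u. Re (boundary_value u)) differentiable (at u)"
  proof (rule real_differentiable_ae_if_dominated_by_mono[of _ g])
    fix x y :: real assume "x \<le> y"
    then show "\<bar>Re (boundary_value y) - Re (boundary_value x)\<bar> \<le> g y - g x"
      using dom[of x y] abs_Re_le_cmod[of "boundary_value y - boundary_value x"] by simp
  qed
  moreover have "AE u in lborel. (\<lambda>u. Im (boundary_value u)) differentiable (at u)"
  proof (rule real_differentiable_ae_if_dominated_by_mono[of _ g])
    fix x y :: real assume "x \<le> y"
    then show "\<bar>Im (boundary_value y) - Im (boundary_value x)\<bar> \<le> g y - g x"
      using dom[of x y] abs_Im_le_cmod[of "boundary_value y - boundary_value x"] by simp
  qed
  ultimately show ?thesis
  proof eventually_elim
    case (elim u)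
    then obtain b1 b2 where "((\<lambda>u. Re (boundary_value u)) has_real_derivative b1) (at u)"
      "((\<lambda>u. Im (boundary_value u)) has_real_derivative b2) (at u)"
      unfolding real_differentiable_def by auto
    then have "(boundary_value has_vector_derivative Complex b1 b2) (at u)"
      unfolding has_vector_derivative_complex_iff by simp
    then show ?case by blast
  qed
qed

lemma nontangential_limit_ae:
  "AE u in lborel. has_nontangential_limit a F (graph_param a u) (upright_limit F (graph_param a u))"
  using boundary_value_differentiable_ae lipschitz_differentiable_ae[OF lip]
proof eventually_elim
  case (elim u)
  then obtain \<beta> \<alpha> where \<beta>: "(boundary_value has_vector_derivative \<beta>) (at u)"
    and \<alpha>: "(a has_real_derivative \<alpha>) (at u)"
    unfolding real_differentiable_def by blast
  have "((\<lambda>u. extension (graph_param a u)) has_vector_derivative \<beta>) (at u)"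
    using \<beta> by (simp add: extension_graph)
  then have *: "has_nontangential_limit a F (graph_param a u) (\<beta> / Complex 1 \<alpha>)"
    using nontangential_limit_if_primitive_differentiable[OF lip extension_has_field_derivative continuous_on_extension \<alpha>]
    by blast
  then show ?case using upright_limit_if_nontangential_limit[OF *] by simp
qed

end

section \<open>The non-tangential boundary limit\<close>

theorem corollary3p5:
  fixes a :: "real \<Rightarrow> real" and M p :: real and F :: "complex \<Rightarrow> complex"
  assumes "0 < M"
    and "\<And>u\<^sub>1 u\<^sub>2. \<bar>a u\<^sub>1 - a u\<^sub>2\<bar> \<le> M * \<bar>u\<^sub>1 - u\<^sub>2\<bar>"
    and "1 < p"
    and "F \<in> hardy_space a p"
  shows "AE z in arc_length_measure a. has_nontangential_limit a F z (upright_limit F z)"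
proof -
  have cont: "continuous_on UNIV a" by (rule lipschitz_imp_continuous[OF assms(2)])
  have hol: "F holomorphic_on upper_domain a" using assms(4) by (simp add: hardy_space_def)
  obtain K :: real where K: "0 \<le> K"
    "\<And>\<tau>. \<tau> > 0 \<Longrightarrow> (\<integral>\<^sup>+ u. ennreal (norm (F (graph_param a u + \<i> * complex_of_real \<tau>)) powr p) \<partial>lborel) \<le> ennreal K"
    using hardy_space_line_bound[OF assms(2,4)] by blast
  obtain \<Phi> where \<Phi>: "\<And>z. z \<in> upper_domain a \<Longrightarrow> (\<Phi> has_field_derivative F z) (at z)"
    using primitive_on_upper_domain[OF cont hol] by blast
  interpret hardy_primitive a M p K F \<Phi>
    by unfold_locales (use assms hol K \<Phi> in auto)
  show ?thesis by (rule AE_arc_length_measureI[OF cont nontangential_limit_ae])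
qed

end
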